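(* Let $\mathsf{dist}$ be a generalized distance on $\mathcal P(\mathbb Z_+)$ satisfying the decomposition property and the sandwich property. Let $p_n^{\mathsf{emp}}=\frac1n\sum_{i=1}^n\delta_{Y_i}$ be the empirical distribution of the training sample, and let $\hat G=\operatorname{argmin}_{Q\in\mathcal P(\mathbb R_+)}\mathsf{dist}(p_n^{\mathsf{emp}}\,\|\,f_Q)$ be the unconstrained minimum-distance estimator. Then there exist constants $c_1,c_2$ such that for all $h>0$ and $s>0$: (a) $\displaystyle\mathsf{Regret}(\hat G;\mathcal P([0,h]))\le\frac{c_1}{n}\left(\min\left\{\max\{1,h\}\frac{\log n}{\log\log n},\ h+\log n\right\}\right)^3$ for any $n\ge3$; (b) $\displaystyle\mathsf{Regret}(\hat G;\mathsf{SubE}(s))\le\frac{c_2\max\{1,s^3\}}{n}(\log n)^3$ for any $n\ge2$. In addition, if the data-generating distribution $G$ is supported on $[0,h]$ for a constant (fixed) $h>0$, then the constrained minimum-distance estimator with access to $h$, $\tilde G=\operatorname{argmin}_{Q\in\mathcal P([0,h])}\mathsf{dist}(p_n^{\mathsf{emp}}\,\|\,f_Q)$, satisfies, for a constant $c_1$ (which may depend on the fixed value $h$) and any $n\ge3$, $$\mathsf{Regret}(\tilde G;\mathcal P([0,h]))\le\frac{c_1}{n}\left(\min\left\{\max\{1,h\}\frac{\log n}{\log\log n},\ h+\log n\right\}\right)^2.$$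
   Context: $\mathbb Z_+=\{0,1,2,\dots\}$, $\mathbb R_+=[0,\infty)$. For a Borel set $\Theta\subset\mathbb R$, $\mathcal P(\Theta)$ is the set of Borel probability measures on $\Theta$; $\mathcal P(\mathbb Z_+)$ is the set of probability mass functions on $\mathbb Z_+$. $\mathsf{SubE}(s)=\{G\in\mathcal P(\mathbb R_+):G([t,\infty))\le 2e^{-t/s}\ \forall t>0\}$. For $G\in\mathcal P(\mathbb R_+)$ the Poisson mixture is $f_G(y)=\int e^{-\theta}\frac{\theta^y}{y!}\,G(d\theta)$, $y\in\mathbb Z_+$ (with $0^0=1$). $H^2(p,q)=\sum_{y\ge0}(\sqrt{p(y)}-\sqrt{q(y)})^2$; $\chi^2(p\|q)=\sum_{y\ge0}\frac{(p(y)-q(y))^2}{q(y)}$. Bayes estimator (posterior mean) under prior $G$: $\hat\theta_G(y)=(y+1)\frac{f_G(y+1)}{f_G(y)}$, with the convention $\hat\theta_G(y)=0$ if $f_G(y)=0$ (which happens only for $G=\delta_0$, $y>0$). Regret: the training sample $Y_1,\dots,Y_n$ and a fresh test point $Y$ are i.i.d. from $f_G$. For an estimator $\hat G$ of $G$ computed from $Y_1,\dots,Y_n$, $$\mathsf{Regret}(\hat G;G)=\mathbb E_G\left[(\hat\theta_{\hat G}(Y)-\hat\theta_G(Y))^2\right]=\mathbb E_G\Big[\sum_{y\ge0}(\hat\theta_{\hat G}(y)-\hat\theta_G(y))^2f_G(y)\Big]$$ (the excess mean squared error over the Bayes risk of estimating $\theta\sim G$ from $Y\mid\theta\sim\mathrm{Poi}(\theta)$),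 where the expectation is also over the training sample; for a class $\mathcal G$, $\mathsf{Regret}(\hat G;\mathcal G)=\sup_{G\in\mathcal G}\mathsf{Regret}(\hat G;G)$. A generalized distance is a map $\mathsf{dist}:\mathcal P(\mathbb Z_+)\times\mathcal P(\mathbb Z_+)\to[0,\infty]$ with $\mathsf{dist}(p\|q)\ge 0$ and equality if and only if $p=q$. Decomposition property: there exist maps $t:\mathcal P(\mathbb Z_+)\to\mathbb R$ and $\ell:[0,\infty)^2\to(-\infty,\infty]$, with $\ell(a,b)$ finite for $b>0$, such that for all $q_1,q_2\in\mathcal P(\mathbb Z_+)$, $\mathsf{dist}(q_1\|q_2)=t(q_1)+\sum_{y\ge0}\ell(q_1(y),q_2(y))$, where $b\mapsto\ell(a,b)$ is strictly decreasing and strictly convex (and continuous on $[0,\infty)$ as an extended-real-valued function) for each $a>0$, and $\ell(0,b)=0$ for all $b\ge0$. (Under this property the minimizers $\hat G,\tilde G$ exist and are unique.) Sandwich property: there exist absolute constants $\kappa_1,\kappa_2>0$ such that $\kappa_1H^2(q_1,q_2)\le\mathsf{dist}(q_1\|q_2)\le\kappa_2\chi^2(q_1\|q_2)$ for all $q_1,q_2\in\mathcal P(\mathbb Z_+)$. In (a), (b), the constants $c_1,c_2$ may depend on $\mathsf{dist}$ (through $\kappa_1,\kappa_2$) but not on $h,s,n$. *)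

theory Defs
  imports "HOL-Probability.Probability"
begin

definition prob_on :: "real set \<Rightarrow> real measure set" where
  "prob_on \<Theta> = {G. prob_space G \<and> sets G = sets borel \<and> emeasure G \<Theta> = 1}"

definition SubE :: "real \<Rightarrow> real measure set" where
  "SubE s = {G \<in> prob_on {0..}. \<forall>t>0. measure G {t..} \<le> 2 * exp (- t / s)}"

definition poisson_mixture :: "real measure \<Rightarrow> nat \<Rightarrow> real" where
  "poisson_mixture G y = (LINT \<theta>|G. exp (- \<theta>) * \<theta> ^ y / fact y)"

definition mixture_pmf :: "real measure \<Rightarrow> nat pmf" where
  "mixture_pmf G = embed_pmf (poisson_mixture G)"

text \<open>The function \<^term>\<open>poisson_mixture G\<close> is a probability mass function as soon as
  \<^term>\<open>G\<close> lives on the nonnegative reals, so that \<^const>\<open>embed_pmf\<close> is meaningful.\<close>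

lemma prob_on_nonneg_AE:
  assumes "G \<in> prob_on {0..}"
  shows "AE \<theta> in G. 0 \<le> \<theta>"
proof -
  interpret prob_space G using assms by (simp add: prob_on_def)
  have s: "sets G = sets borel" and e: "emeasure G {0..} = 1"
    using assms by (auto simp: prob_on_def)
  have "AE \<theta> in G. \<theta> \<in> {0..}"
    by (rule AE_prob_1) (simp add: measure_def e)
  then show ?thesis by simp
qed

lemma ennreal_poisson_mixture:
  assumes "G \<in> prob_on {0..}"
  shows "ennreal (poisson_mixture G y) = (\<integral>\<^sup>+\<theta>. ennreal (exp (- \<theta>) * \<theta> ^ y / fact y) \<partial>G)"
    and "0 \<le> poisson_mixture G y"
proof -
  interpret prob_space G using assms by (simp add: prob_on_def)
  have s[measurable_cong]: "sets G = sets borel"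
    using assms by (auto simp: prob_on_def)
  note nn = prob_on_nonneg_AE[OF assms]
  have bound: "exp (- \<theta>) * \<theta> ^ y / fact y \<le> 1" if "0 \<le> \<theta>" for \<theta> :: real
  proof -
    have "\<theta> ^ y / fact y \<le> exp \<theta>"
    proof -
      have sm: "(\<lambda>n. \<theta> ^ n / fact n) sums exp \<theta>"
        using exp_converges[of \<theta>] by (simp add: scaleR_conv_of_real divide_inverse mult.commute)
      have "sum (\<lambda>n. \<theta> ^ n / fact n) {y} \<le> suminf (\<lambda>n. \<theta> ^ n / fact n)"
        by (rule sum_le_suminf) (use sm that in \<open>auto simp: sums_iff\<close>)
      then show ?thesis using sm by (simp add: sums_iff)
    qed
    then show ?thesis
      by (simp add: exp_minus field_simps)
  qed
  have int: "integrable G (\<lambda>\<theta>. exp (- \<theta>) * \<theta> ^ y / fact y)"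
    by (rule integrable_const_bound[where B = 1]) (use nn bound in \<open>auto elim!: eventually_mono\<close>)
  have nn': "AE \<theta> in G. 0 \<le> exp (- \<theta>) * \<theta> ^ y / fact y"
    using nn by (auto elim!: eventually_mono)
  show "ennreal (poisson_mixture G y) = (\<integral>\<^sup>+\<theta>. ennreal (exp (- \<theta>) * \<theta> ^ y / fact y) \<partial>G)"
    unfolding poisson_mixture_def using nn_integral_eq_integral[OF int nn'] by simp
  show "0 \<le> poisson_mixture G y"
    unfolding poisson_mixture_def using nn' by (rule integral_nonneg_AE)
qed

lemma pmf_mixture_pmf:
  assumes "G \<in> prob_on {0..}"
  shows "pmf (mixture_pmf G) y = poisson_mixture G y"
  unfolding mixture_pmf_def
proof (rule pmf_embed_pmf)
  interpret prob_space G using assms by (simp add: prob_on_def)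
  have s[measurable_cong]: "sets G = sets borel"
    using assms by (auto simp: prob_on_def)
  show "0 \<le> poisson_mixture G x" for x
    by (rule ennreal_poisson_mixture(2)[OF assms])
  have one: "(\<Sum>y. ennreal (exp (- \<theta>) * \<theta> ^ y / fact y)) = 1" if "0 \<le> \<theta>" for \<theta> :: real
  proof -
    have "(\<lambda>y. exp (- \<theta>) * (\<theta> ^ y / fact y)) sums (exp (- \<theta>) * exp \<theta>)"
      using exp_converges[of \<theta>] by (intro sums_mult) (simp add: divide_inverse mult.commute)
    then have "(\<lambda>y. exp (- \<theta>) * \<theta> ^ y / fact y) sums 1"
      by (simp add: exp_minus)
    then show ?thesis
      using that by (subst suminf_ennreal2) (auto simp: sums_iff)
  qed
  have "(\<integral>\<^sup>+x. ennreal (poisson_mixture G x) \<partial>count_space UNIV)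
      = (\<Sum>y. \<integral>\<^sup>+\<theta>. ennreal (exp (- \<theta>) * \<theta> ^ y / fact y) \<partial>G)"
    by (simp add: nn_integral_count_space_nat ennreal_poisson_mixture(1)[OF assms])
  also have "\<dots> = (\<integral>\<^sup>+\<theta>. (\<Sum>y. ennreal (exp (- \<theta>) * \<theta> ^ y / fact y)) \<partial>G)"
    by (rule nn_integral_suminf[symmetric]) measurable
  also have "\<dots> = (\<integral>\<^sup>+\<theta>. 1 \<partial>G)"
    by (rule nn_integral_cong_AE) (use prob_on_nonneg_AE[OF assms] one in \<open>auto elim!: eventually_mono\<close>)
  also have "\<dots> = 1"
    by (simp add: emeasure_space_1)
  finally show "(\<integral>\<^sup>+x. ennreal (poisson_mixture G x) \<partial>count_space UNIV) = 1" .
qed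

definition hellinger_sq :: "nat pmf \<Rightarrow> nat pmf \<Rightarrow> ennreal" where
  "hellinger_sq p q = (\<Sum>y. ennreal ((sqrt (pmf p y) - sqrt (pmf q y))\<^sup>2))"

text \<open>Division in \<^typ>\<open>ennreal\<close> gives \<open>0 / 0 = 0\<close> and \<open>x / 0 = \<infinity>\<close> for \<open>x > 0\<close>, the usual
  conventions for the chi-squared divergence.\<close>

definition chi_sq :: "nat pmf \<Rightarrow> nat pmf \<Rightarrow> ennreal" where
  "chi_sq p q = (\<Sum>y. ennreal ((pmf p y - pmf q y)\<^sup>2) / ennreal (pmf q y))"

definition generalized_distance :: "(nat pmf \<Rightarrow> nat pmf \<Rightarrow> ennreal) \<Rightarrow> bool" where
  "generalized_distance dst \<longleftrightarrow> (\<forall>p q. dst p q = 0 \<longleftrightarrow> p = q)"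

text \<open>The \<open>loss\<close> takes values in \<open>(-\<infinity>, \<infinity>]\<close> and only its restriction to nonnegative arguments
  matters. The series is the limit of its partial sums in the extended reals.\<close>

definition decomposable :: "(nat pmf \<Rightarrow> nat pmf \<Rightarrow> ennreal) \<Rightarrow> bool" where
  "decomposable dst \<longleftrightarrow>
    (\<exists>(t :: nat pmf \<Rightarrow> real) (loss :: real \<Rightarrow> real \<Rightarrow> ereal).
      (\<forall>a\<ge>0. \<forall>b\<ge>0. loss a b \<noteq> - \<infinity>) \<and>
      (\<forall>a\<ge>0. \<forall>b>0. loss a b \<noteq> \<infinity>) \<and>
      (\<forall>q1 q2. \<exists>S. (\<lambda>y. loss (pmf q1 y) (pmf q2 y)) sums S \<and>
         enn2ereal (dst q1 q2) = ereal (t q1) + S) \<and>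
      (\<forall>a>0. \<forall>b1\<ge>0. \<forall>b2>b1. loss a b2 < loss a b1) \<and>
      (\<forall>a>0. \<forall>b1\<ge>0. \<forall>b2\<ge>0. \<forall>u. b1 \<noteq> b2 \<longrightarrow> 0 < u \<longrightarrow> u < 1 \<longrightarrow>
         loss a ((1 - u) * b1 + u * b2) < ereal (1 - u) * loss a b1 + ereal u * loss a b2) \<and>
      (\<forall>a>0. continuous_on {0..} (loss a)) \<and>
      (\<forall>b\<ge>0. loss 0 b = 0))"

definition sandwiched :: "real \<Rightarrow> real \<Rightarrow> (nat pmf \<Rightarrow> nat pmf \<Rightarrow> ennreal) \<Rightarrow> bool" where
  "sandwiched \<kappa>1 \<kappa>2 dst \<longleftrightarrow>
    (\<forall>q1 q2. ennreal \<kappa>1 * hellinger_sq q1 q2 \<le> dst q1 q2 \<and>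
             dst q1 q2 \<le> ennreal \<kappa>2 * chi_sq q1 q2)"

definition bayes_estimator :: "real measure \<Rightarrow> nat \<Rightarrow> real" where
  "bayes_estimator G y =
    (if poisson_mixture G y = 0 then 0
     else real (y + 1) * poisson_mixture G (y + 1) / poisson_mixture G y)"

text \<open>An estimator maps the list of the \<open>n\<close> training observations to a mixing distribution;
  \<^const>\<open>replicate_pmf\<close> is the law of \<open>n\<close> independent draws.\<close>

definition regret :: "nat \<Rightarrow> (nat list \<Rightarrow> real measure) \<Rightarrow> real measure \<Rightarrow> ennreal" where
  "regret n Ghat G =
    (\<integral>\<^sup>+ ys. (\<integral>\<^sup>+ y. ennreal ((bayes_estimator (Ghat ys) y - bayes_estimator G y)\<^sup>2)
       \<partial>measure_pmf (mixture_pmf G)) \<partial>measure_pmf (replicate_pmf n (mixture_pmf G)))"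

definition regret_class :: "nat \<Rightarrow> (nat list \<Rightarrow> real measure) \<Rightarrow> real measure set \<Rightarrow> ennreal" where
  "regret_class n Ghat \<G> = (SUP G\<in>\<G>. regret n Ghat G)"

definition empirical :: "nat list \<Rightarrow> nat pmf" where
  "empirical ys = pmf_of_multiset (mset ys)"

definition min_dist_estimator ::
    "(nat pmf \<Rightarrow> nat pmf \<Rightarrow> ennreal) \<Rightarrow> real set \<Rightarrow> nat list \<Rightarrow> real measure" where
  "min_dist_estimator dst \<Theta> ys =
    (ARG_MIN (\<lambda>Q. dst (empirical ys) (mixture_pmf Q)) Q. Q \<in> prob_on \<Theta>)"

end

theory Submission
  imports Defs
begin

text \<open>
  By the sandwich property and minimality, the squared Hellinger distance between the fitted and the
  true mixture is at most a constant times the chi-squared divergence of the empirical distribution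
  from the true mixture. On the event that all observations are at most \<open>K\<close>, the latter has
  expectation of order \<open>K / n\<close>. On the same event the fitted prior lives on \<open>[0, M]\<close>, where
  \<open>M = K\<close> for the unconstrained estimator (mass beyond the largest observation could be moved to it
  with a gain in every term of the loss) and \<open>M = max 1 h\<close> for the constrained one, so that both
  posterior means are at most \<open>M\<close> up to a negligible set, and the regret is bounded by \<open>K M\<close> times
  the squared Hellinger distance. Choosing \<open>K\<close> so that an observation exceeds it with probability of
  order \<open>n\<^sup>-\<^sup>2\<close> makes the remaining contributions negligible; the total is of order \<open>K\<^sup>2 M / n\<close>.
\<close>

section \<open>Poisson mixtures and posterior means\<close>

text \<open>Three obstacles shape the argument. The fitted mixture may be tiny where the true one is
  not, so posterior means cannot be compared by dividing; the estimates work with products of a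
  posterior mean and a mass, which are again masses, taken at the next integer.
  \<open>ARG_MIN\<close> is a choice operator, so nothing is known about the estimator before a
  minimizer is exhibited; on \<open>{0..}\<close> priors can escape to infinity, and clamping at the
  largest observation brings back a compact interval. On the rare samples with an observation beyond
  \<open>K\<close> the fitted posterior mean is controlled only by the sample maximum, and bounding
  the square of the maximum by a sum over the sample costs a factor \<open>n\<close>; hence tails of
  order n^-2 rather than n^-1. The minimum in the bounded rate reflects two choices of exponent in a
  Chernoff bound. For subexponential priors the true posterior mean is itself unbounded and inherits
  an exponential moment from the prior.\<close>

lemma prob_on_mono:
  assumes "G \<in> prob_on A" "A \<subseteq> B" "B \<in> sets borel"
  shows "G \<in> prob_on B"
proof -
  interpret prob_space G using assms by (simp add: prob_on_def)
  have "emeasure G A \<le> emeasure G B"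
    using assms by (intro emeasure_mono) (auto simp: prob_on_def)
  moreover have "emeasure G B \<le> 1" by (rule emeasure_le_1)
  ultimately show ?thesis using assms by (auto simp: prob_on_def intro: antisym)
qed

lemma prob_on_AE:
  assumes "G \<in> prob_on A"
  shows "AE \<theta> in G. \<theta> \<in> A"
proof -
  interpret prob_space G using assms by (simp add: prob_on_def)
  show ?thesis
    by (rule AE_prob_1) (use assms in \<open>simp add: prob_on_def measure_def\<close>)
qed

lemma prob_on_intro:
  assumes "prob_space G" "sets G = sets borel" "A \<in> sets borel" "AE \<theta> in G. \<theta> \<in> A"
  shows "G \<in> prob_on A"
proof -
  interpret prob_space G by fact
  have "emeasure G A = emeasure G (space G)"
    using assms by (intro emeasure_eq_AE) auto
  then show ?thesis using assms by (simp add: prob_on_def emeasure_space_1)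
qed

lemma real_distribution_prob_on: "Q \<in> prob_on A \<Longrightarrow> real_distribution Q"
  by (simp add: prob_on_def real_distribution_def real_distribution_axioms_def)

lemma poisson_kernel_le_1:
  assumes "0 \<le> (\<theta>::real)"
  shows "exp (- \<theta>) * \<theta> ^ y / fact y \<le> 1"
proof -
  have sm: "(\<lambda>n. \<theta> ^ n / fact n) sums exp \<theta>"
    using exp_converges[of \<theta>] by (simp add: scaleR_conv_of_real divide_inverse mult.commute)
  have "sum (\<lambda>n. \<theta> ^ n / fact n) {y} \<le> suminf (\<lambda>n. \<theta> ^ n / fact n)"
    by (rule sum_le_suminf) (use sm assms in \<open>auto simp: sums_iff\<close>)
  then show ?thesis using sm by (simp add: sums_iff exp_minus field_simps)
qed

lemma integrable_poisson_kernel: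
  assumes "G \<in> prob_on {0..}"
  shows "integrable G (\<lambda>\<theta>. exp (- \<theta>) * \<theta> ^ y / fact y)"
proof -
  interpret prob_space G using assms by (simp add: prob_on_def)
  have [measurable_cong]: "sets G = sets borel" using assms by (simp add: prob_on_def)
  show ?thesis
    by (rule integrable_const_bound[where B = 1])
       (use prob_on_AE[OF assms] poisson_kernel_le_1 in \<open>auto elim!: eventually_mono\<close>)
qed

text \<open>Source of the posterior mean formula: averaged over the prior, the right side becomes
  \<open>(y + 1) * poisson_mixture G (y + 1)\<close>. It also makes \<open>\<theta>\<close> times
  the weight integrable without any moment of the prior, as a multiple of the next weight.\<close>

lemma poisson_kernel_Suc:
  "\<theta> * (exp (- \<theta>) * \<theta> ^ y / fact y) = real (Suc y) * (exp (- \<theta>) * \<theta> ^ Suc y / fact (Suc y))"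
  for \<theta> :: real
  by (simp add: field_simps del: of_nat_Suc)

lemma integrable_times_poisson_kernel:
  assumes "G \<in> prob_on {0..}"
  shows "integrable G (\<lambda>\<theta>. \<theta> * (exp (- \<theta>) * \<theta> ^ y / fact y))"
  unfolding poisson_kernel_Suc using integrable_poisson_kernel[OF assms] by (intro integrable_mult_right)

lemma poisson_mixture_Suc:
  "real (Suc y) * poisson_mixture G (Suc y)
     = (LINT \<theta>|G. \<theta> * (exp (- \<theta>) * \<theta> ^ y / fact y))"
  unfolding poisson_mixture_def poisson_kernel_Suc by simp

text \<open>Kept free of division so that it also speaks about zero mass: there it forces the next
  mass to vanish.\<close>

lemma poisson_mixture_Suc_le:
  assumes "G \<in> prob_on {0..M}"
  shows "real (Suc y) * poisson_mixture G (Suc y) \<le> M * poisson_mixture G y"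
proof -
  have G: "G \<in> prob_on {0..}" using assms by (rule prob_on_mono) auto
  have "(LINT \<theta>|G. \<theta> * (exp (- \<theta>) * \<theta> ^ y / fact y)) \<le> (LINT \<theta>|G. M * (exp (- \<theta>) * \<theta> ^ y / fact y))"
  proof (rule integral_mono_AE)
    show "AE \<theta> in G. \<theta> * (exp (- \<theta>) * \<theta> ^ y / fact y) \<le> M * (exp (- \<theta>) * \<theta> ^ y / fact y)"
      using prob_on_AE[OF assms]
    proof (eventually_elim)
      case (elim \<theta>)
      then show ?case by (intro mult_right_mono divide_nonneg_nonneg mult_nonneg_nonneg) auto
    qed
  qed (rule integrable_times_poisson_kernel[OF G] integrable_mult_right integrable_poisson_kernel[OF G])+
  then show ?thesis unfolding poisson_mixture_Suc by (simp add: poisson_mixture_def)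
qed

lemma bayes_estimator_mult:
  "poisson_mixture G y \<noteq> 0 \<Longrightarrow>
    bayes_estimator G y * poisson_mixture G y = real (Suc y) * poisson_mixture G (Suc y)"
  by (simp add: bayes_estimator_def)

lemma bayes_estimator_nonneg: "G \<in> prob_on {0..} \<Longrightarrow> 0 \<le> bayes_estimator G y"
  by (simp add: bayes_estimator_def ennreal_poisson_mixture(2))

lemma bayes_estimator_le:
  assumes "G \<in> prob_on {0..M}" "0 \<le> M"
  shows "bayes_estimator G y \<le> M"
proof (cases "poisson_mixture G y = 0")
  case False
  have G: "G \<in> prob_on {0..}" using assms(1) by (rule prob_on_mono) auto
  have "0 < poisson_mixture G y" using False ennreal_poisson_mixture(2)[OF G, of y] by simp
  then show ?thesis using poisson_mixture_Suc_le[OF assms(1), of y]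
    by (simp add: bayes_estimator_def field_simps)
qed (use assms in \<open>simp add: bayes_estimator_def\<close>)

lemma nn_integral_nat_pmf:
  "(\<integral>\<^sup>+ y. \<phi> y \<partial>measure_pmf p) = (\<Sum>y. ennreal (pmf p y) * \<phi> y)"
  by (simp add: nn_integral_measure_pmf nn_integral_count_space_nat)

section \<open>Exponential moments of observations and of posterior means\<close>

lemma nn_integral_mixture_exp:
  assumes G: "G \<in> prob_on {0..}"
  shows "(\<integral>\<^sup>+ y. ennreal (exp (a * real y)) \<partial>measure_pmf (mixture_pmf G))
     = (\<integral>\<^sup>+ \<theta>. ennreal (exp (\<theta> * (exp a - 1))) \<partial>G)"
proof -
  have [measurable_cong]: "sets G = sets borel" using G by (simp add: prob_on_def)
  have AE: "AE \<theta> in G. 0 \<le> \<theta>" by (rule prob_on_nonneg_AE[OF G])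
  have "(\<integral>\<^sup>+ y. ennreal (exp (a * real y)) \<partial>measure_pmf (mixture_pmf G))
      = (\<Sum>y. \<integral>\<^sup>+\<theta>. ennreal (exp (- \<theta>) * \<theta> ^ y / fact y) * ennreal (exp (a * real y)) \<partial>G)"
    by (simp add: nn_integral_nat_pmf pmf_mixture_pmf[OF G] ennreal_poisson_mixture(1)[OF G]
        nn_integral_multc)
  also have "\<dots> = (\<integral>\<^sup>+\<theta>. (\<Sum>y. ennreal (exp (- \<theta>) * \<theta> ^ y / fact y) * ennreal (exp (a * real y))) \<partial>G)"
    by (rule nn_integral_suminf[symmetric]) measurable
  also have "\<dots> = (\<integral>\<^sup>+ \<theta>. ennreal (exp (\<theta> * (exp a - 1))) \<partial>G)"
  proof (rule nn_integral_cong_AE, use AE in eventually_elim)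
    fix \<theta> :: real assume \<theta>: "0 \<le> \<theta>"
    \<comment> \<open>The Poisson moment generating function: \<open>exp (a * y)\<close> merely
      rescales \<open>\<theta>\<close> to \<open>\<theta> * exp a\<close> in the exponential
      series.\<close>
    have "(\<lambda>y. exp (- \<theta>) * ((\<theta> * exp a) ^ y / fact y)) sums (exp (- \<theta>) * exp (\<theta> * exp a))"
      using exp_converges[of "\<theta> * exp a"] by (intro sums_mult) (simp add: divide_inverse mult.commute)
    then have s: "(\<lambda>y. exp (- \<theta>) * \<theta> ^ y / fact y * exp (a * real y)) sums exp (\<theta> * (exp a - 1))"
      by (simp add: exp_of_nat2_mult power_mult_distrib algebra_simps flip: exp_add)
    have "(\<Sum>y. ennreal (exp (- \<theta>) * \<theta> ^ y / fact y) * ennreal (exp (a * real y)))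
        = (\<Sum>y. ennreal (exp (- \<theta>) * \<theta> ^ y / fact y * exp (a * real y)))"
      by (intro suminf_cong, subst ennreal_mult'') auto
    also have "\<dots> = ennreal (exp (\<theta> * (exp a - 1)))"
      using s \<theta> by (subst suminf_ennreal2) (auto simp: sums_iff)
    finally show "(\<Sum>y. ennreal (exp (- \<theta>) * \<theta> ^ y / fact y) * ennreal (exp (a * real y)))
        = ennreal (exp (\<theta> * (exp a - 1)))" .
  qed
  finally show ?thesis .
qed

text \<open>Meant for integrands that change sign, whose negative part \<open>ennreal\<close> cuts
  off. In the Jensen step below the integrand is a tangent line times a weight and may be
  negative.\<close>

lemma ennreal_integral_le_nn_integral:
  fixes g :: "'a \<Rightarrow> real"
  assumes "integrable M g"
  shows "ennreal (integral\<^sup>L M g) \<le> (\<integral>\<^sup>+x. ennreal (g x) \<partial>M)"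
proof -
  have i: "integrable M (\<lambda>x. max 0 (g x))" using assms by simp
  have "integral\<^sup>L M g \<le> (LINT x|M. max 0 (g x))"
    by (rule integral_mono) (use assms i in auto)
  then have "ennreal (integral\<^sup>L M g) \<le> ennreal (LINT x|M. max 0 (g x))" by (rule ennreal_leI)
  also have "\<dots> = (\<integral>\<^sup>+x. ennreal (max 0 (g x)) \<partial>M)"
    using nn_integral_eq_integral[OF i] by simp
  also have "\<dots> = (\<integral>\<^sup>+x. ennreal (g x) \<partial>M)"
    by (intro nn_integral_cong) (auto simp: max_def ennreal_neg)
  finally show ?thesis .
qed

text \<open>Jensen's inequality for the posterior distribution, via the tangent line of \<open>exp\<close> at the
  posterior mean.\<close>

lemma nn_integral_exp_bayes_le:
  assumes G: "G \<in> prob_on {0..}"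
  shows "(\<integral>\<^sup>+ y. ennreal (exp (l * bayes_estimator G y)) \<partial>measure_pmf (mixture_pmf G))
     \<le> (\<integral>\<^sup>+ \<theta>. ennreal (exp (l * \<theta>)) \<partial>G)"
proof -
  have [measurable_cong]: "sets G = sets borel" using G by (simp add: prob_on_def)
  have AE: "AE \<theta> in G. 0 \<le> \<theta>" by (rule prob_on_nonneg_AE[OF G])
  let ?k = "\<lambda>y \<theta>::real. exp (- \<theta>) * \<theta> ^ y / fact y"
  have le: "ennreal (pmf (mixture_pmf G) y) * ennreal (exp (l * bayes_estimator G y))
      \<le> (\<integral>\<^sup>+\<theta>. ennreal (?k y \<theta>) * ennreal (exp (l * \<theta>)) \<partial>G)" for y
  proof (cases "poisson_mixture G y = 0")
    case True
    then show ?thesis by (simp add: pmf_mixture_pmf[OF G])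
  next
    case False
    define m where "m = bayes_estimator G y"
    \<comment> \<open>The tangent line at \<open>m\<close> times the weight, expanded into two
      functions already known to be integrable. As \<open>m\<close> is the posterior mean, the terms
      with factor \<open>l\<close> cancel on integration.\<close>
    define g where "g \<theta> = exp (l * m) * ((1 - l * m) * ?k y \<theta> + l * (\<theta> * ?k y \<theta>))" for \<theta>
    have ig: "integrable G g"
      unfolding g_def using integrable_poisson_kernel[OF G] integrable_times_poisson_kernel[OF G]
      by (intro integrable_mult_right Bochner_Integration.integrable_add)
    have "integral\<^sup>L G g
        = exp (l * m) * ((1 - l * m) * poisson_mixture G y + l * (real (Suc y) * poisson_mixture G (Suc y)))"
      unfolding g_def poisson_mixture_Suc
      unfolding poisson_mixture_def integral_mult_right_zero
      by (subst Bochner_Integration.integral_add)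
         (intro integrable_mult_right integrable_poisson_kernel[OF G]
            integrable_times_poisson_kernel[OF G] | simp only: integral_mult_right_zero)+
    also have "\<dots> = exp (l * m) * poisson_mixture G y"
      using bayes_estimator_mult[OF False] unfolding m_def[symmetric]
      by (simp add: algebra_simps)
    finally have eq: "exp (l * m) * poisson_mixture G y = integral\<^sup>L G g" by simp
    have "ennreal (pmf (mixture_pmf G) y) * ennreal (exp (l * m)) = ennreal (integral\<^sup>L G g)"
      unfolding pmf_mixture_pmf[OF G] eq[symmetric]
      using ennreal_poisson_mixture(2)[OF G, of y] by (simp add: ennreal_mult' mult.commute)
    also have "\<dots> \<le> (\<integral>\<^sup>+\<theta>. ennreal (g \<theta>) \<partial>G)"
      by (rule ennreal_integral_le_nn_integral[OF ig])
    also have "\<dots> \<le> (\<integral>\<^sup>+\<theta>. ennreal (?k y \<theta>) * ennreal (exp (l * \<theta>)) \<partial>G)"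
    proof (rule nn_integral_mono_AE, use AE in eventually_elim)
      fix \<theta> :: real assume \<theta>: "0 \<le> \<theta>"
      have "1 + l * (\<theta> - m) \<le> exp (l * (\<theta> - m))" by (rule exp_ge_add_one_self)
      then have "exp (l * m) * (1 + l * (\<theta> - m)) \<le> exp (l * m) * exp (l * (\<theta> - m))"
        by (intro mult_left_mono) auto
      also have "\<dots> = exp (l * \<theta>)" by (simp add: algebra_simps flip: exp_add)
      finally have "?k y \<theta> * (exp (l * m) * (1 + l * (\<theta> - m))) \<le> ?k y \<theta> * exp (l * \<theta>)"
        using \<theta> by (intro mult_left_mono) auto
      moreover have "exp (l * m) * ((1 - l * m) * k + l * (\<theta> * k)) = k * (exp (l * m) * (1 + l * (\<theta> - m)))" for k
        by (simp add: algebra_simps)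
      ultimately have "g \<theta> \<le> ?k y \<theta> * exp (l * \<theta>)" by (simp only: g_def)
      then have "ennreal (g \<theta>) \<le> ennreal (?k y \<theta> * exp (l * \<theta>))" by (rule ennreal_leI)
      then show "ennreal (g \<theta>) \<le> ennreal (?k y \<theta>) * ennreal (exp (l * \<theta>))"
        using \<theta> by (subst ennreal_mult[symmetric]) auto
    qed
    finally show ?thesis by (simp add: m_def)
  qed
  have one: "(\<Sum>y. ennreal (?k y \<theta>)) = 1" if "0 \<le> \<theta>" for \<theta>
  proof -
    have "(\<lambda>y. exp (- \<theta>) * (\<theta> ^ y / fact y)) sums (exp (- \<theta>) * exp \<theta>)"
      using exp_converges[of \<theta>] by (intro sums_mult) (simp add: divide_inverse mult.commute)
    then show ?thesis
      using that by (subst suminf_ennreal2) (auto simp: sums_iff exp_minus)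
  qed
  have "(\<integral>\<^sup>+ y. ennreal (exp (l * bayes_estimator G y)) \<partial>measure_pmf (mixture_pmf G))
      \<le> (\<Sum>y. \<integral>\<^sup>+\<theta>. ennreal (?k y \<theta>) * ennreal (exp (l * \<theta>)) \<partial>G)"
    unfolding nn_integral_nat_pmf by (intro suminf_le le) auto
  also have "\<dots> = (\<integral>\<^sup>+\<theta>. (\<Sum>y. ennreal (?k y \<theta>) * ennreal (exp (l * \<theta>))) \<partial>G)"
    by (rule nn_integral_suminf[symmetric]) measurable
  also have "\<dots> = (\<integral>\<^sup>+ \<theta>. ennreal (exp (l * \<theta>)) \<partial>G)"
    by (rule nn_integral_cong_AE, use AE in eventually_elim)
       (simp only: ennreal_suminf_multc one mult_1)
  finally show ?thesis .
qed

section \<open>The empirical distribution\<close>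

lemma nn_integral_pmf_if_eq:
  "(\<integral>\<^sup>+ x. (if x = y then a else b) \<partial>measure_pmf p)
     = ennreal (pmf p y) * a + ennreal (1 - pmf p y) * b"
proof -
  have "(\<integral>\<^sup>+ x. (if x = y then a else b) \<partial>measure_pmf p)
      = (\<integral>\<^sup>+ x. a * indicator {y} x + b * indicator (- {y}) x \<partial>measure_pmf p)"
    by (intro nn_integral_cong) (auto split: split_indicator)
  also have "\<dots> = a * emeasure (measure_pmf p) {y} + b * emeasure (measure_pmf p) (- {y})"
    by (subst nn_integral_add) (auto simp: nn_integral_cmult_indicator)
  also have "emeasure (measure_pmf p) (- {y}) = ennreal (1 - pmf p y)"
    using measure_pmf.prob_compl[of "{y}" p]
    by (simp add: measure_pmf.emeasure_eq_measure Compl_eq_Diff_UNIV measure_pmf_single)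
  also have "emeasure (measure_pmf p) {y} = ennreal (pmf p y)"
    by (simp add: emeasure_pmf_single)
  finally show ?thesis by (simp add: mult.commute)
qed

text \<open>The shift \<open>c\<close> makes the induction go through without computing the mean separately.\<close>

lemma nn_integral_count_variance:
  "(\<integral>\<^sup>+ ys. ennreal ((real (count (mset ys) y) - real n * pmf p y + c)\<^sup>2) \<partial>measure_pmf (replicate_pmf n p))
     = ennreal (real n * pmf p y * (1 - pmf p y) + c\<^sup>2)"
proof (induction n arbitrary: c)
  case (Suc n)
  let ?q = "pmf p y"
  have q: "0 \<le> ?q" "?q \<le> 1" by (auto simp: pmf_le_1)
  let ?A = "real n * ?q * (1 - ?q)"
  have A: "0 \<le> ?A" using q by simp
  have "(\<integral>\<^sup>+ ys. ennreal ((real (count (mset ys) y) - real (Suc n) * ?q + c)\<^sup>2) \<partial>measure_pmf (replicate_pmf (Suc n) p))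
      = (\<integral>\<^sup>+ x. \<integral>\<^sup>+ ys. ennreal ((real (count (mset ys) y) - real n * ?q
           + (c - ?q + (if x = y then 1 else 0)))\<^sup>2) \<partial>measure_pmf (replicate_pmf n p) \<partial>measure_pmf p)"
    by (auto simp: algebra_simps intro!: nn_integral_cong)
  also have "\<dots> = (\<integral>\<^sup>+ x. (if x = y then ennreal (?A + (c - ?q + 1)\<^sup>2) else ennreal (?A + (c - ?q)\<^sup>2)) \<partial>measure_pmf p)"
    unfolding Suc by (intro nn_integral_cong) simp
  also have "\<dots> = ennreal (?q * (?A + (c - ?q + 1)\<^sup>2) + (1 - ?q) * (?A + (c - ?q)\<^sup>2))"
    unfolding nn_integral_pmf_if_eq using q A by (simp add: ennreal_plus ennreal_mult)
  also have "?q * (?A + (c - ?q + 1)\<^sup>2) + (1 - ?q) * (?A + (c - ?q)\<^sup>2) = real (Suc n) * ?q * (1 - ?q) + c\<^sup>2"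
    by (simp add: algebra_simps power2_eq_square)
  finally show ?case .
qed simp

lemma pmf_empirical:
  assumes "ys \<noteq> []"
  shows "pmf (empirical ys) y = real (count (mset ys) y) / real (length ys)"
  using assms by (simp add: empirical_def)

lemma nn_integral_empirical_variance:
  assumes "n > 0"
  shows "(\<integral>\<^sup>+ ys. ennreal ((pmf (empirical ys) y - pmf p y)\<^sup>2) \<partial>measure_pmf (replicate_pmf n p))
     = ennreal (pmf p y * (1 - pmf p y) / real n)"
proof -
  have "(\<integral>\<^sup>+ ys. ennreal ((pmf (empirical ys) y - pmf p y)\<^sup>2) \<partial>measure_pmf (replicate_pmf n p))
     = (\<integral>\<^sup>+ ys. ennreal (1 / (real n)\<^sup>2) * ennreal ((real (count (mset ys) y) - real n * pmf p y + 0)\<^sup>2)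
         \<partial>measure_pmf (replicate_pmf n p))"
  proof (rule nn_integral_cong_AE, subst AE_measure_pmf_iff, rule ballI)
    fix ys assume "ys \<in> set_pmf (replicate_pmf n p)"
    then have l: "length ys = n" "ys \<noteq> []" using assms by (auto simp: set_replicate_pmf)
    have *: "(pmf (empirical ys) y - pmf p y)\<^sup>2
        = 1 / (real n)\<^sup>2 * (real (count (mset ys) y) - real n * pmf p y + 0)\<^sup>2"
      using assms l by (simp add: pmf_empirical field_simps power2_eq_square)
    show "ennreal ((pmf (empirical ys) y - pmf p y)\<^sup>2)
      = ennreal (1 / (real n)\<^sup>2) * ennreal ((real (count (mset ys) y) - real n * pmf p y + 0)\<^sup>2)"
      unfolding * by (rule ennreal_mult) auto
  qed
  also have "\<dots> = ennreal (1 / (real n)\<^sup>2) * ennreal (real n * pmf p y * (1 - pmf p y) + 0\<^sup>2)"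
    by (subst nn_integral_cmult) (simp_all only: nn_integral_count_variance, simp)
  also have "\<dots> = ennreal (1 / (real n)\<^sup>2 * (real n * pmf p y * (1 - pmf p y)))"
    using pmf_le_1[of p y] by (subst ennreal_mult[symmetric]) auto
  also have "1 / (real n)\<^sup>2 * (real n * pmf p y * (1 - pmf p y)) = pmf p y * (1 - pmf p y) / real n"
    using assms by (simp add: field_simps power2_eq_square)
  finally show ?thesis .
qed

text \<open>Linearity of expectation. For a \<open>g\<close> that vanishes up to \<open>K\<close> it
  turns a bound through the sample maximum into \<open>n\<close> times a tail integral.\<close>

lemma nn_integral_sum_list_replicate_pmf:
  "(\<integral>\<^sup>+ ys. sum_list (map g ys) \<partial>measure_pmf (replicate_pmf n p))
     = of_nat n * (\<integral>\<^sup>+ y. g y \<partial>measure_pmf p)"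
proof (induction n)
  case (Suc n)
  have "(\<integral>\<^sup>+ ys. sum_list (map g ys) \<partial>measure_pmf (replicate_pmf (Suc n) p))
     = (\<integral>\<^sup>+ x. g x + of_nat n * (\<integral>\<^sup>+ y. g y \<partial>measure_pmf p) \<partial>measure_pmf p)"
    by (simp add: nn_integral_add Suc)
  also have "\<dots> = of_nat (Suc n) * (\<integral>\<^sup>+ y. g y \<partial>measure_pmf p)"
    by (simp add: nn_integral_add distrib_right)
  finally show ?case .
qed simp

lemma card_nat_le_real:
  assumes "0 \<le> K"
  shows "finite {y. real y \<le> K}" "real (card {y. real y \<le> K}) \<le> K + 1"
proof -
  have eq: "{y. real y \<le> K} = {..nat \<lfloor>K\<rfloor>}"
    using assms by (auto simp: le_nat_iff le_floor_iff)
  show "finite {y. real y \<le> K}" unfolding eq by simp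
  show "real (card {y. real y \<le> K}) \<le> K + 1" unfolding eq using assms by simp
qed

text \<open>Without the restriction to samples bounded by \<open>K\<close> the left-hand side is infinite
  whenever \<open>p\<close> has infinite support.\<close>

lemma nn_integral_chi_sq_truncated:
  assumes "n > 0" "0 \<le> K"
  shows "(\<integral>\<^sup>+ ys. chi_sq (empirical ys) p * indicator {ys. \<forall>y\<in>set ys. real y \<le> K} ys
            \<partial>measure_pmf (replicate_pmf n p))
     \<le> ennreal ((K + 1) / real n) + emeasure (measure_pmf p) {y. K < real y}"
proof -
  let ?P = "measure_pmf (replicate_pmf n p)"
  let ?F = "{y. real y \<le> K}"
  let ?t = "\<lambda>ys y. ennreal ((pmf (empirical ys) y - pmf p y)\<^sup>2) / ennreal (pmf p y)"
  note fin = card_nat_le_real[OF assms(2)]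
  \<comment> \<open>An unobserved value contributes exactly its own mass to the divergence, or
    \<open>0 / 0 = 0\<close> when that mass is zero.\<close>
  have term_le: "ennreal ((0 - pmf p y)\<^sup>2) / ennreal (pmf p y) \<le> ennreal (pmf p y)" for y
  proof (cases "pmf p y = 0")
    case False
    then show ?thesis by (simp add: divide_ennreal power2_eq_square)
  qed simp
  have "(\<integral>\<^sup>+ ys. chi_sq (empirical ys) p * indicator {ys. \<forall>y\<in>set ys. real y \<le> K} ys \<partial>?P)
    \<le> (\<integral>\<^sup>+ ys. (\<Sum>y\<in>?F. ?t ys y) + emeasure (measure_pmf p) {y. K < real y} \<partial>?P)"
  proof (rule nn_integral_mono_AE, subst AE_measure_pmf_iff, rule ballI)
    fix ys assume "ys \<in> set_pmf (replicate_pmf n p)"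
    then have l: "length ys = n" "ys \<noteq> []" using assms by (auto simp: set_replicate_pmf)
    show "chi_sq (empirical ys) p * indicator {ys. \<forall>y\<in>set ys. real y \<le> K} ys
      \<le> (\<Sum>y\<in>?F. ?t ys y) + emeasure (measure_pmf p) {y. K < real y}"
    proof (cases "\<forall>y\<in>set ys. real y \<le> K")
      case True
      \<comment> \<open>Values up to \<open>K\<close> keep their term; values beyond
        \<open>K\<close> are unobserved, and together they add at most the tail probability.\<close>
      have "?t ys y \<le> ?t ys y * indicator ?F y + ennreal (pmf p y) * indicator {y. K < real y} y" for y
      proof (cases "real y \<le> K")
        case False
        then have "y \<notin> set ys" using True by auto
        then have "pmf (empirical ys) y = 0" using l by (simp add: pmf_empirical count_mset_0_iff)
        then show ?thesis using False term_le[of y] by simp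
      qed simp
      then have "chi_sq (empirical ys) p
        \<le> (\<Sum>y. ?t ys y * indicator ?F y + ennreal (pmf p y) * indicator {y. K < real y} y)"
        unfolding chi_sq_def by (intro suminf_le) auto
      also have "\<dots> = (\<Sum>y. ?t ys y * indicator ?F y) + (\<Sum>y. ennreal (pmf p y) * indicator {y. K < real y} y)"
        by (intro suminf_add[symmetric]) auto
      also have "(\<Sum>y. ?t ys y * indicator ?F y) = (\<Sum>y\<in>?F. ?t ys y * indicator ?F y)"
        using fin(1) by (intro suminf_finite) auto
      also have "\<dots> = (\<Sum>y\<in>?F. ?t ys y)" by (intro sum.cong) auto
      also have "(\<Sum>y. ennreal (pmf p y) * indicator {y. K < real y} y) = emeasure (measure_pmf p) {y. K < real y}"
        unfolding nn_integral_nat_pmf[symmetric] by simp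
      finally show ?thesis using True by simp
    qed simp
  qed
  also have "\<dots> = (\<Sum>y\<in>?F. \<integral>\<^sup>+ ys. ?t ys y \<partial>?P) + emeasure (measure_pmf p) {y. K < real y}"
    by (subst nn_integral_add) (auto simp: nn_integral_sum)
  also have "(\<Sum>y\<in>?F. \<integral>\<^sup>+ ys. ?t ys y \<partial>?P) \<le> (\<Sum>y\<in>?F. ennreal (1 / real n))"
  proof (rule sum_mono)
    fix y
    have "(\<integral>\<^sup>+ ys. ?t ys y \<partial>?P) = ennreal (pmf p y * (1 - pmf p y) / real n) / ennreal (pmf p y)"
      unfolding nn_integral_empirical_variance[OF assms(1), symmetric]
      by (simp add: nn_integral_divide)
    \<comment> \<open>Variance over mass is \<open>(1 - pmf p y) / n\<close>: a value costs at most
      \<open>1 / n\<close> however rare it is, and at most \<open>K + 1\<close> values are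
      counted.\<close>
    also have "\<dots> \<le> ennreal (1 / real n)"
    proof (cases "pmf p y = 0")
      case False
      then have "0 < pmf p y" by (simp add: pmf_positive_iff less_le)
      then show ?thesis using pmf_le_1[of p y]
        by (subst divide_ennreal) (auto simp: divide_right_mono intro!: ennreal_leI)
    qed simp
    finally show "(\<integral>\<^sup>+ ys. ?t ys y \<partial>?P) \<le> ennreal (1 / real n)" .
  qed
  also have "(\<Sum>y\<in>?F. ennreal (1 / real n)) = ennreal (real (card ?F) * (1 / real n))"
    by (subst sum_ennreal) auto
  also have "\<dots> \<le> ennreal ((K + 1) / real n)"
    using fin(2) by (intro ennreal_leI) (simp add: divide_right_mono)
  finally show ?thesis by (simp add: add_right_mono)
qed

section \<open>From Hellinger distance to regret\<close>

text \<open>Squaring termwise costs a factor 2 but needs no root of a series. The middle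
  distribution stands first because the empirical distribution is the first argument of the
  distance.\<close>

lemma hellinger_sq_triangle:
  "hellinger_sq p r \<le> 2 * hellinger_sq q p + 2 * hellinger_sq q r"
proof -
  have *: "ennreal ((sqrt (pmf p y) - sqrt (pmf r y))\<^sup>2)
      \<le> 2 * ennreal ((sqrt (pmf q y) - sqrt (pmf p y))\<^sup>2) + 2 * ennreal ((sqrt (pmf q y) - sqrt (pmf r y))\<^sup>2)" for y
  proof -
    have "(a - c)\<^sup>2 \<le> 2 * (b - a)\<^sup>2 + 2 * (b - c)\<^sup>2" for a b c :: real
      using zero_le_power2[of "a + c - 2 * b"] by (simp add: power2_eq_square algebra_simps)
    then have "ennreal ((sqrt (pmf p y) - sqrt (pmf r y))\<^sup>2)
        \<le> ennreal (2 * (sqrt (pmf q y) - sqrt (pmf p y))\<^sup>2 + 2 * (sqrt (pmf q y) - sqrt (pmf r y))\<^sup>2)"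
      by (rule ennreal_leI)
    then show ?thesis by (simp add: ennreal_plus ennreal_mult)
  qed
  have "hellinger_sq p r \<le> (\<Sum>y. 2 * ennreal ((sqrt (pmf q y) - sqrt (pmf p y))\<^sup>2) + 2 * ennreal ((sqrt (pmf q y) - sqrt (pmf r y))\<^sup>2))"
    unfolding hellinger_sq_def by (intro suminf_le *) auto
  also have "\<dots> = 2 * hellinger_sq q p + 2 * hellinger_sq q r"
    unfolding hellinger_sq_def by (subst suminf_add[symmetric]) auto
  finally show ?thesis .
qed

text \<open>Trades a difference of masses for a Hellinger term. The price \<open>a + b\<close> is
  what the normalization by the sum of both mixtures later cancels.\<close>

lemma sq_diff_le_sqrt:
  assumes "0 \<le> a" "0 \<le> (b::real)"
  shows "(a - b)\<^sup>2 \<le> 2 * (a + b) * (sqrt a - sqrt b)\<^sup>2"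
proof -
  have "(a - b)\<^sup>2 = (sqrt a + sqrt b)\<^sup>2 * (sqrt a - sqrt b)\<^sup>2"
    using assms by (simp add: power_mult_distrib[symmetric] algebra_simps)
  also have "\<dots> \<le> (2 * (a + b)) * (sqrt a - sqrt b)\<^sup>2"
  proof (rule mult_right_mono)
    have "(sqrt a + sqrt b)\<^sup>2 \<le> (sqrt a + sqrt b)\<^sup>2 + (sqrt a - sqrt b)\<^sup>2" by simp
    also have "\<dots> = 2 * (a + b)" using assms by (simp add: power2_eq_square algebra_simps)
    finally show "(sqrt a + sqrt b)\<^sup>2 \<le> 2 * (a + b)" .
  qed simp
  finally show ?thesis .
qed

text \<open>The posterior means \<open>u = w f1 / f\<close> and \<open>v = w g1 / g\<close>, where \<open>w = y + 1\<close>, are compared with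
  \<open>2 w f1 / (f + g)\<close> and \<open>2 w g1 / (f + g)\<close>; this avoids dividing by the possibly tiny \<open>g\<close>.\<close>

lemma posterior_mean_diff_bound:
  fixes f g f1 g1 u v w M :: real
  assumes f: "0 < f" and nn: "0 \<le> g" "0 \<le> f1" "0 \<le> g1" "0 \<le> w"
    and u: "u * f = w * f1" "0 \<le> u" "u \<le> M" and v: "v * g = w * g1" "0 \<le> v" "v \<le> M"
  shows "f * (v - u)\<^sup>2 \<le> 16 * M\<^sup>2 * (sqrt g - sqrt f)\<^sup>2 + 16 * w * M * (sqrt g1 - sqrt f1)\<^sup>2"
proof -
  define s where "s = f + g"
  have s: "0 < s" "f \<le> s" using f nn by (auto simp: s_def)
  \<comment> \<open>Arranged so that \<open>u\<close> and \<open>v\<close> occur only beside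
    \<open>g - f\<close> or inside \<open>u * f\<close> and \<open>v * g\<close>, which are
    \<open>w * f1\<close> and \<open>w * g1\<close>.\<close>
  have "(u - v) * s = (u + v) * (g - f) + 2 * (u * f - v * g)"
    by (simp add: s_def algebra_simps)
  also have "\<dots> = (u + v) * (g - f) + 2 * w * (f1 - g1)"
    unfolding u v by (simp add: algebra_simps)
  finally have id: "(u - v) * s = (u + v) * (g - f) + 2 * w * (f1 - g1)" .
  have "((u - v) * s)\<^sup>2 \<le> 2 * ((u + v) * (g - f))\<^sup>2 + 2 * (2 * w * (f1 - g1))\<^sup>2"
  proof -
    have "(a + b)\<^sup>2 \<le> 2 * a\<^sup>2 + 2 * b\<^sup>2" for a b :: real
      using zero_le_power2[of "a - b"] by (simp add: power2_eq_square algebra_simps)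
    then show ?thesis unfolding id .
  qed
  also have "\<dots> = 2 * (u + v)\<^sup>2 * (g - f)\<^sup>2 + 8 * w * (w * (g1 - f1)\<^sup>2)"
    by (simp add: power2_eq_square algebra_simps)
  also have "\<dots> \<le> 2 * (4 * M\<^sup>2) * (2 * s * (sqrt g - sqrt f)\<^sup>2) + 8 * w * (2 * (M * s) * (sqrt g1 - sqrt f1)\<^sup>2)"
  proof (rule add_mono)
    have "(u + v)\<^sup>2 \<le> (2 * M)\<^sup>2" using u v by (intro power_mono) auto
    then have a: "2 * (u + v)\<^sup>2 \<le> 2 * (4 * M\<^sup>2)" by simp
    have b: "(g - f)\<^sup>2 \<le> 2 * s * (sqrt g - sqrt f)\<^sup>2"
      using sq_diff_le_sqrt[of g f] f nn by (simp add: s_def add.commute)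
    show "2 * (u + v)\<^sup>2 * (g - f)\<^sup>2 \<le> 2 * (4 * M\<^sup>2) * (2 * s * (sqrt g - sqrt f)\<^sup>2)"
      by (rule mult_mono[OF a b]) auto
    \<comment> \<open>One factor \<open>w\<close> is absorbed here: \<open>w * (g1 + f1)\<close>
      equals \<open>u * f + v * g\<close>, which is at most \<open>M * s\<close>. This leaves
      \<open>w * M\<close> instead of \<open>w\<^sup>2\<close> in the bound.\<close>
    have "w * (g1 - f1)\<^sup>2 \<le> w * (2 * (g1 + f1) * (sqrt g1 - sqrt f1)\<^sup>2)"
      using sq_diff_le_sqrt[of g1 f1] nn by (intro mult_left_mono) auto
    also have "\<dots> = 2 * (u * f + v * g) * (sqrt g1 - sqrt f1)\<^sup>2"
      unfolding u v by (simp add: algebra_simps)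
    also have "\<dots> \<le> 2 * (M * s) * (sqrt g1 - sqrt f1)\<^sup>2"
      unfolding s_def distrib_left[of M]
      using f nn by (intro mult_right_mono mult_left_mono add_mono u v) auto
    finally show "8 * w * (w * (g1 - f1)\<^sup>2) \<le> 8 * w * (2 * (M * s) * (sqrt g1 - sqrt f1)\<^sup>2)"
      using nn by (intro mult_left_mono) auto
  qed
  also have "\<dots> = s * (16 * M\<^sup>2 * (sqrt g - sqrt f)\<^sup>2 + 16 * w * M * (sqrt g1 - sqrt f1)\<^sup>2)"
    by (simp add: algebra_simps)
  finally have "s * (s * (v - u)\<^sup>2) \<le> s * (16 * M\<^sup>2 * (sqrt g - sqrt f)\<^sup>2 + 16 * w * M * (sqrt g1 - sqrt f1)\<^sup>2)"
    by (simp add: power_mult_distrib power2_commute power2_eq_square algebra_simps)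
  then have "s * (v - u)\<^sup>2 \<le> 16 * M\<^sup>2 * (sqrt g - sqrt f)\<^sup>2 + 16 * w * M * (sqrt g1 - sqrt f1)\<^sup>2"
    using s(1) by (rule mult_left_le_imp_le)
  moreover have "f * (v - u)\<^sup>2 \<le> s * (v - u)\<^sup>2" using s by (intro mult_right_mono) auto
  ultimately show ?thesis by linarith
qed

text \<open>Extends \<open>bayes_estimator_mult\<close> to points of zero mass, where the default
  value 0 is consistent because the next mass vanishes too. A prior concentrated at 0 has such
  points.\<close>

lemma bayes_estimator_mult_bounded:
  assumes "Q \<in> prob_on {0..M}"
  shows "bayes_estimator Q y * poisson_mixture Q y = real (Suc y) * poisson_mixture Q (Suc y)"
proof (cases "poisson_mixture Q y = 0")
  case True
  have "Q \<in> prob_on {0..}" using assms by (rule prob_on_mono) auto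
  then have "0 \<le> real (Suc y) * poisson_mixture Q (Suc y)"
    by (simp add: ennreal_poisson_mixture(2))
  moreover have "real (Suc y) * poisson_mixture Q (Suc y) \<le> 0"
    using poisson_mixture_Suc_le[OF assms, of y] True by simp
  ultimately show ?thesis using True by simp
qed (rule bayes_estimator_mult)

lemma suminf_shift_le_ennreal: "(\<Sum>y. \<phi> (Suc y)) \<le> (\<Sum>y. \<phi> y :: ennreal)"
proof -
  have "(\<Sum>y. \<phi> y) = (\<Sum>y. \<phi> (y + 1)) + (\<Sum>i<1. \<phi> i)"
    by (rule suminf_offset) auto
  then show ?thesis by simp
qed

text \<open>The pointwise comparison applies where \<open>y\<close> is at most \<open>K\<close> and
  the true posterior mean at most \<open>M\<close>. Of the other points, those with a large
  posterior mean are paid for by the last term and the rest by the tail probability.\<close>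

lemma regret_integral_le_hellinger:
  assumes G: "G \<in> prob_on {0..}" and Q: "Q \<in> prob_on {0..M}" and M: "1 \<le> M" "M \<le> K"
  shows "(\<integral>\<^sup>+ y. ennreal ((bayes_estimator Q y - bayes_estimator G y)\<^sup>2) \<partial>measure_pmf (mixture_pmf G))
    \<le> ennreal (48 * K * M) * hellinger_sq (mixture_pmf G) (mixture_pmf Q)
      + ennreal (4 * M\<^sup>2) * emeasure (measure_pmf (mixture_pmf G)) {y. K < real y}
      + 4 * (\<integral>\<^sup>+ y. ennreal ((bayes_estimator G y)\<^sup>2) * indicator {y. M < bayes_estimator G y} y
              \<partial>measure_pmf (mixture_pmf G))"
proof -
  have Q0: "Q \<in> prob_on {0..}" using Q by (rule prob_on_mono) auto
  let ?p = "mixture_pmf G"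
  let ?f = "poisson_mixture G" and ?g = "poisson_mixture Q"
  let ?u = "bayes_estimator G" and ?v = "bayes_estimator Q"
  let ?H = "\<lambda>y. ennreal ((sqrt (pmf ?p y) - sqrt (pmf (mixture_pmf Q) y))\<^sup>2)"
  have uv: "0 \<le> ?u y" "0 \<le> ?v y" "?v y \<le> M" for y
    using bayes_estimator_nonneg[OF G] bayes_estimator_nonneg[OF Q0] bayes_estimator_le[OF Q] M by auto
  have f: "0 \<le> ?f y" "0 \<le> ?g y" for y
    using ennreal_poisson_mixture(2)[OF G] ennreal_poisson_mixture(2)[OF Q0] by auto
  let ?a = "\<lambda>y. ennreal (16 * K * M) * ?H y + ennreal (32 * K * M) * ?H (Suc y)"
  let ?b = "\<lambda>y. ennreal (4 * M\<^sup>2) * indicator {y. K < real y} y"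
  let ?c = "\<lambda>y. 4 * (ennreal ((?u y)\<^sup>2) * indicator {y. M < ?u y} y)"
  have pw: "ennreal (pmf ?p y) * ennreal ((?v y - ?u y)\<^sup>2)
      \<le> ?a y + ennreal (pmf ?p y) * (?b y + ?c y)" for y
  proof -
    have sq: "(?v y - ?u y)\<^sup>2 \<le> (max (?v y) (?u y))\<^sup>2"
      using uv[of y] by (intro abs_le_square_iff[THEN iffD1]) auto
    consider "?f y = 0" | "0 < ?f y" "M < ?u y" | "0 < ?f y" "?u y \<le> M" "K < real y"
      | "0 < ?f y" "?u y \<le> M" "real y \<le> K"
      using f(1)[of y] by linarith
    then show ?thesis
    proof cases
      case 1
      then show ?thesis by (simp add: pmf_mixture_pmf[OF G])
    next
      case 2
      have "(max (?v y) (?u y))\<^sup>2 \<le> 4 * (?u y)\<^sup>2" using 2 uv[of y] by (simp add: max_def)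
      then have "ennreal ((?v y - ?u y)\<^sup>2) \<le> ennreal (4 * (?u y)\<^sup>2)"
        using sq by (intro ennreal_leI) linarith
      then have "ennreal ((?v y - ?u y)\<^sup>2) \<le> ?c y" using 2 by (simp add: ennreal_mult)
      then have "ennreal ((?v y - ?u y)\<^sup>2) \<le> ?b y + ?c y" by (rule add_increasing[rotated]) simp
      then show ?thesis by (rule add_increasing[OF zero_le mult_left_mono]) simp
    next
      case 3
      have "(max (?v y) (?u y))\<^sup>2 \<le> M\<^sup>2" using 3 uv[of y] by (intro power_mono) auto
      also have "\<dots> \<le> 4 * M\<^sup>2" by simp
      finally have "ennreal ((?v y - ?u y)\<^sup>2) \<le> ennreal (4 * M\<^sup>2)"
        using sq by (intro ennreal_leI) linarith
      then have "ennreal ((?v y - ?u y)\<^sup>2) \<le> ?b y" using 3 by simp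
      then have "ennreal ((?v y - ?u y)\<^sup>2) \<le> ?b y + ?c y" by (rule add_increasing2[rotated]) simp
      then show ?thesis by (rule add_increasing[OF zero_le mult_left_mono]) simp
    next
      case 4
      have "?f y * (?v y - ?u y)\<^sup>2
          \<le> 16 * M\<^sup>2 * (sqrt (?g y) - sqrt (?f y))\<^sup>2 + 16 * real (Suc y) * M * (sqrt (?g (Suc y)) - sqrt (?f (Suc y)))\<^sup>2"
        using 4 uv f bayes_estimator_mult[of G y] bayes_estimator_mult_bounded[OF Q]
        by (intro posterior_mean_diff_bound) auto
      \<comment> \<open>Here \<open>y + 1 \<le> 2 * K\<close>, from \<open>y \<le> K\<close> and
        \<open>1 \<le> K\<close>. The coefficients 16 and 32 add up to 48 once the shifted sum is
        bounded by the full one.\<close>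
      also have "\<dots> \<le> 16 * K * M * (sqrt (?g y) - sqrt (?f y))\<^sup>2 + 32 * K * M * (sqrt (?g (Suc y)) - sqrt (?f (Suc y)))\<^sup>2"
        using M 4 by (intro add_mono mult_right_mono) (auto simp: power2_eq_square intro!: mult_right_mono)
      finally have "ennreal (?f y * (?v y - ?u y)\<^sup>2) \<le> ennreal (\<dots>)" by (rule ennreal_leI)
      then have "ennreal (pmf ?p y) * ennreal ((?v y - ?u y)\<^sup>2) \<le> ?a y"
        using M f by (simp add: pmf_mixture_pmf[OF G] pmf_mixture_pmf[OF Q0] ennreal_plus ennreal_mult
            power2_commute[of "sqrt (?g _)"])
      then show ?thesis by (rule add_increasing2[rotated]) simp
    qed
  qed
  have "(\<integral>\<^sup>+ y. ennreal ((?v y - ?u y)\<^sup>2) \<partial>measure_pmf ?p) \<le> (\<Sum>y. ?a y + ennreal (pmf ?p y) * (?b y + ?c y))"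
    unfolding nn_integral_nat_pmf by (intro suminf_le pw) auto
  also have "\<dots> = (\<Sum>y. ?a y) + (\<Sum>y. ennreal (pmf ?p y) * (?b y + ?c y))"
    by (intro suminf_add[symmetric]) auto
  also have "(\<Sum>y. ?a y) = ennreal (16 * K * M) * (\<Sum>y. ?H y) + ennreal (32 * K * M) * (\<Sum>y. ?H (Suc y))"
    by (subst suminf_add[symmetric]) auto
  also have "\<dots> \<le> ennreal (16 * K * M) * (\<Sum>y. ?H y) + ennreal (32 * K * M) * (\<Sum>y. ?H y)"
    by (intro add_mono mult_left_mono suminf_shift_le_ennreal) auto
  also have "\<dots> = ennreal (48 * K * M) * hellinger_sq ?p (mixture_pmf Q)"
    using M by (simp add: hellinger_sq_def distrib_right[symmetric] ennreal_plus[symmetric] del: ennreal_plus)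
  also have "(\<Sum>y. ennreal (pmf ?p y) * (?b y + ?c y)) = (\<integral>\<^sup>+ y. ?b y + ?c y \<partial>measure_pmf ?p)"
    by (rule nn_integral_nat_pmf[symmetric])
  also have "\<dots> = ennreal (4 * M\<^sup>2) * emeasure (measure_pmf ?p) {y. K < real y}
      + 4 * (\<integral>\<^sup>+ y. ennreal ((?u y)\<^sup>2) * indicator {y. M < ?u y} y \<partial>measure_pmf ?p)"
    by (subst nn_integral_add) (auto simp: nn_integral_cmult nn_integral_cmult_indicator)
  finally show ?thesis by (simp add: add.assoc add_right_mono)
qed

section \<open>Averaging the regret over the training sample\<close>

lemma nn_integral_replicate_le_sum_list:
  assumes "\<And>ys. length ys = n \<Longrightarrow> D ys \<le> E ys + sum_list (map g ys)"
  shows "(\<integral>\<^sup>+ ys. D ys \<partial>measure_pmf (replicate_pmf n p))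
    \<le> (\<integral>\<^sup>+ ys. E ys \<partial>measure_pmf (replicate_pmf n p)) + of_nat n * (\<integral>\<^sup>+ y. g y \<partial>measure_pmf p)"
proof -
  have "(\<integral>\<^sup>+ ys. D ys \<partial>measure_pmf (replicate_pmf n p))
      \<le> (\<integral>\<^sup>+ ys. E ys + sum_list (map g ys) \<partial>measure_pmf (replicate_pmf n p))"
    by (rule nn_integral_mono_AE) (auto simp: AE_measure_pmf_iff set_replicate_pmf assms)
  then show ?thesis by (simp add: nn_integral_add nn_integral_sum_list_replicate_pmf)
qed

text \<open>Common core of all three bounds. \<open>M\<close> limits the support of the fitted prior
  on samples bounded by \<open>K\<close>, and \<open>A\<close> collects the constants of the three
  moment conditions. Only \<open>tail\<close> asks for n^-2: it is paid once for each of the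
  \<open>n\<close> observations.\<close>

lemma regret_le:
  fixes \<kappa> K M A :: real
  assumes G: "G \<in> prob_on {0..}" and n: "n > 0" and M: "1 \<le> M" "M \<le> K"
    and pos: "0 < \<kappa>" "0 \<le> A"
    and dst: "\<And>ys. length ys = n \<Longrightarrow>
      hellinger_sq (mixture_pmf G) (mixture_pmf (Ghat ys)) \<le> ennreal \<kappa> * chi_sq (empirical ys) (mixture_pmf G)"
    and small: "\<And>ys. length ys = n \<Longrightarrow> \<forall>y\<in>set ys. real y \<le> K \<Longrightarrow> Ghat ys \<in> prob_on {0..M}"
    and large: "\<And>ys. length ys = n \<Longrightarrow> \<exists>y\<in>set ys. K < real y \<Longrightarrow> Ghat ys \<in> prob_on {0..real (Max (set ys))}"
    and tail: "(\<integral>\<^sup>+ y. ennreal ((real y)\<^sup>2) * indicator {y. K < real y} y \<partial>measure_pmf (mixture_pmf G))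
      \<le> ennreal (A * K\<^sup>2 * M / (real n)\<^sup>2)"
    and second: "(\<integral>\<^sup>+ y. ennreal ((bayes_estimator G y)\<^sup>2) \<partial>measure_pmf (mixture_pmf G)) \<le> ennreal (A * K\<^sup>2)"
    and big: "(\<integral>\<^sup>+ y. ennreal ((bayes_estimator G y)\<^sup>2) * indicator {y. M < bayes_estimator G y} y
        \<partial>measure_pmf (mixture_pmf G)) \<le> ennreal (A * K\<^sup>2 * M / real n)"
  shows "regret n Ghat G \<le> ennreal ((48 * \<kappa> * (2 + A) + 10 * A + 2 * A\<^sup>2) * (K\<^sup>2 * M / real n))"
proof -
  let ?p = "mixture_pmf G"
  let ?P = "measure_pmf (replicate_pmf n ?p)"
  let ?u = "bayes_estimator G"
  let ?D = "\<lambda>ys. (\<integral>\<^sup>+ y. ennreal ((bayes_estimator (Ghat ys) y - ?u y)\<^sup>2) \<partial>measure_pmf ?p)"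
  let ?S = "{ys. \<forall>y\<in>set ys. real y \<le> K}"
  define \<epsilon> where "\<epsilon> = emeasure (measure_pmf ?p) {y. K < real y}"
  define R where "R = ennreal (4 * M\<^sup>2) * \<epsilon> + 4 * ennreal (A * K\<^sup>2 * M / real n)"
  define C where "C = ennreal (48 * K * M) * ennreal \<kappa>"
  \<comment> \<open>Cost of a sample whose maximum \<open>y\<close> lies beyond \<open>K\<close>:
    twice the bound on the second moment of the true posterior mean plus twice the square of the
    bound on the fitted one.\<close>
  define g where "g y = (ennreal (2 * (A * K\<^sup>2)) + ennreal (2 * (real y)\<^sup>2)) * indicator {y. K < real y} y" for y
  have D: "?D ys \<le> (C * (chi_sq (empirical ys) ?p * indicator ?S ys) + R) + sum_list (map g ys)"
    if l: "length ys = n" for ys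
  proof (cases "ys \<in> ?S")
    case True
    have "?D ys \<le> ennreal (48 * K * M) * hellinger_sq ?p (mixture_pmf (Ghat ys))
      + ennreal (4 * M\<^sup>2) * emeasure (measure_pmf ?p) {y. K < real y}
      + 4 * (\<integral>\<^sup>+ y. ennreal ((?u y)\<^sup>2) * indicator {y. M < ?u y} y \<partial>measure_pmf ?p)"
      using True by (intro regret_integral_le_hellinger G small l M) auto
    also have "\<dots> \<le> ennreal (48 * K * M) * (ennreal \<kappa> * chi_sq (empirical ys) ?p)
      + ennreal (4 * M\<^sup>2) * emeasure (measure_pmf ?p) {y. K < real y}
      + 4 * ennreal (A * K\<^sup>2 * M / real n)"
      by (intro add_mono mult_left_mono dst l big) auto
    also have "\<dots> = C * (chi_sq (empirical ys) ?p * indicator ?S ys) + R"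
      using True by (simp add: C_def R_def \<epsilon>_def mult.assoc add.assoc)
    finally show ?thesis by (rule add_increasing2[rotated]) simp
  next
    case False
    then obtain z where z: "z \<in> set ys" "K < real z" by (auto simp: not_le)
    define Y where "Y = Max (set ys)"
    have Y: "Y \<in> set ys" "z \<le> Y" using z by (auto simp: Y_def intro!: Max_in)
    have KY: "K < real Y" using z Y by linarith
    have Q: "Ghat ys \<in> prob_on {0..real Y}" unfolding Y_def using z by (intro large l) auto
    have Q0: "Ghat ys \<in> prob_on {0..}" using Q by (rule prob_on_mono) auto
    have "?D ys \<le> (\<integral>\<^sup>+ y. 2 * ennreal ((?u y)\<^sup>2) + ennreal (2 * (real Y)\<^sup>2) \<partial>measure_pmf ?p)"
    proof (rule nn_integral_mono)
      fix y
      let ?v = "bayes_estimator (Ghat ys) y"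
      have v: "0 \<le> ?v" "?v \<le> real Y"
        using bayes_estimator_nonneg[OF Q0] bayes_estimator_le[OF Q] by auto
      have "(?v - ?u y)\<^sup>2 \<le> 2 * (?u y)\<^sup>2 + 2 * ?v\<^sup>2"
        using zero_le_power2[of "?v + ?u y"] by (simp add: power2_eq_square algebra_simps)
      also have "\<dots> \<le> 2 * (?u y)\<^sup>2 + 2 * (real Y)\<^sup>2"
        using v by (intro add_left_mono mult_left_mono power_mono) auto
      finally have "ennreal ((?v - ?u y)\<^sup>2) \<le> ennreal (2 * (?u y)\<^sup>2 + 2 * (real Y)\<^sup>2)" by (rule ennreal_leI)
      also have "\<dots> = 2 * ennreal ((?u y)\<^sup>2) + ennreal (2 * (real Y)\<^sup>2)"
        by (simp add: ennreal_plus ennreal_mult)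
      finally show "ennreal ((?v - ?u y)\<^sup>2) \<le> \<dots>" .
    qed
    also have "\<dots> = 2 * (\<integral>\<^sup>+ y. ennreal ((?u y)\<^sup>2) \<partial>measure_pmf ?p) + ennreal (2 * (real Y)\<^sup>2)"
      by (simp add: nn_integral_add nn_integral_cmult)
    also have "\<dots> \<le> 2 * ennreal (A * K\<^sup>2) + ennreal (2 * (real Y)\<^sup>2)"
      by (intro add_right_mono mult_left_mono second) auto
    also have "\<dots> = g Y" using KY pos by (simp add: g_def ennreal_mult)
    also have "\<dots> \<le> sum_list (map g ys)" using Y by (intro member_le_sum_list) auto
    finally show ?thesis by (rule add_increasing[rotated]) simp
  qed
  have eps: "\<epsilon> \<le> ennreal (A * M / (real n)\<^sup>2)"
  proof -
    \<comment> \<open>Chebyshev's argument: beyond \<open>K\<close> the square is at least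
      \<open>K\<^sup>2\<close>, so the second-moment tail controls the probability.\<close>
    have "ennreal (K\<^sup>2) * \<epsilon> = (\<integral>\<^sup>+ y. ennreal (K\<^sup>2) * indicator {y. K < real y} y \<partial>measure_pmf ?p)"
      by (simp add: \<epsilon>_def nn_integral_cmult_indicator)
    also have "\<dots> \<le> (\<integral>\<^sup>+ y. ennreal ((real y)\<^sup>2) * indicator {y. K < real y} y \<partial>measure_pmf ?p)"
      using M by (intro nn_integral_mono) (auto split: split_indicator intro!: ennreal_leI power_mono)
    also have "\<dots> \<le> ennreal (A * K\<^sup>2 * M / (real n)\<^sup>2)" by (rule tail)
    also have "\<dots> = ennreal (K\<^sup>2) * ennreal (A * M / (real n)\<^sup>2)"
      using pos M by (subst ennreal_mult[symmetric]) (auto simp: ac_simps)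
    finally show ?thesis
      using M by (subst (asm) ennreal_mult_le_mult_iff) auto
  qed
  have g: "(\<integral>\<^sup>+ y. g y \<partial>measure_pmf ?p) \<le> ennreal (2 * (A + 1) * (A * K\<^sup>2 * M / (real n)\<^sup>2))"
  proof -
    have "(\<integral>\<^sup>+ y. g y \<partial>measure_pmf ?p)
      = (\<integral>\<^sup>+ y. ennreal (2 * (A * K\<^sup>2)) * indicator {y. K < real y} y
          + 2 * (ennreal ((real y)\<^sup>2) * indicator {y. K < real y} y) \<partial>measure_pmf ?p)"
      by (intro nn_integral_cong) (auto simp: g_def ennreal_mult split: split_indicator)
    also have "\<dots> = ennreal (2 * (A * K\<^sup>2)) * \<epsilon>
        + 2 * (\<integral>\<^sup>+ y. ennreal ((real y)\<^sup>2) * indicator {y. K < real y} y \<partial>measure_pmf ?p)"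
      by (simp add: nn_integral_add nn_integral_cmult nn_integral_cmult_indicator \<epsilon>_def)
    also have "\<dots> \<le> ennreal (2 * (A * K\<^sup>2)) * ennreal (A * M / (real n)\<^sup>2) + 2 * ennreal (A * K\<^sup>2 * M / (real n)\<^sup>2)"
      by (intro add_mono mult_left_mono eps tail) auto
    also have "\<dots> = ennreal (2 * (A * K\<^sup>2) * (A * M / (real n)\<^sup>2) + 2 * (A * K\<^sup>2 * M / (real n)\<^sup>2))"
    proof -
      have "ennreal (2 * a) * ennreal b + 2 * ennreal c = ennreal (2 * a * b + 2 * c)"
        if "0 \<le> a" "0 \<le> b" "0 \<le> c" for a b c :: real
        using that by (simp add: ennreal_plus ennreal_mult)
      then show ?thesis using pos M by simp
    qed
    also have "2 * (A * K\<^sup>2) * (A * M / (real n)\<^sup>2) + 2 * (A * K\<^sup>2 * M / (real n)\<^sup>2)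
        = 2 * (A + 1) * (A * K\<^sup>2 * M / (real n)\<^sup>2)"
      using n by (simp add: field_simps)
    finally show ?thesis .
  qed
  have "regret n Ghat G \<le> (\<integral>\<^sup>+ ys. C * (chi_sq (empirical ys) ?p * indicator ?S ys) + R \<partial>?P)
      + of_nat n * (\<integral>\<^sup>+ y. g y \<partial>measure_pmf ?p)"
    unfolding regret_def by (rule nn_integral_replicate_le_sum_list[OF D])
  also have "(\<integral>\<^sup>+ ys. C * (chi_sq (empirical ys) ?p * indicator ?S ys) + R \<partial>?P)
      = C * (\<integral>\<^sup>+ ys. chi_sq (empirical ys) ?p * indicator ?S ys \<partial>?P) + R"
    by (simp add: nn_integral_add nn_integral_cmult)
  also have "\<dots> + of_nat n * (\<integral>\<^sup>+ y. g y \<partial>measure_pmf ?p)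
     \<le> C * (ennreal ((K + 1) / real n) + ennreal (A * M / (real n)\<^sup>2))
        + (ennreal (4 * M\<^sup>2) * ennreal (A * M / (real n)\<^sup>2) + 4 * ennreal (A * K\<^sup>2 * M / real n))
        + of_nat n * ennreal (2 * (A + 1) * (A * K\<^sup>2 * M / (real n)\<^sup>2))"
  proof (intro add_mono mult_left_mono g)
    have "(\<integral>\<^sup>+ ys. chi_sq (empirical ys) ?p * indicator ?S ys \<partial>?P)
        \<le> ennreal ((K + 1) / real n) + emeasure (measure_pmf ?p) {y. K < real y}"
      using n M by (intro nn_integral_chi_sq_truncated) auto
    also have "\<dots> \<le> ennreal ((K + 1) / real n) + ennreal (A * M / (real n)\<^sup>2)"
      using eps by (intro add_left_mono) (simp add: \<epsilon>_def)
    finally show "(\<integral>\<^sup>+ ys. chi_sq (empirical ys) ?p * indicator ?S ys \<partial>?P) \<le> \<dots>" .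
    show "R \<le> ennreal (4 * M\<^sup>2) * ennreal (A * M / (real n)\<^sup>2) + 4 * ennreal (A * K\<^sup>2 * M / real n)"
      unfolding R_def by (intro add_right_mono mult_left_mono eps) auto
  qed auto
  also have "\<dots> = ennreal (48 * K * M * \<kappa> * ((K + 1) / real n + A * M / (real n)\<^sup>2)
        + (4 * M\<^sup>2 * (A * M / (real n)\<^sup>2) + 4 * (A * K\<^sup>2 * M / real n))
        + real n * (2 * (A + 1) * (A * K\<^sup>2 * M / (real n)\<^sup>2)))"
  proof -
    have "ennreal a * ennreal k * (ennreal b + ennreal c) + (ennreal d * ennreal c + 4 * ennreal e) + ennreal m * ennreal q
        = ennreal (a * k * (b + c) + (d * c + 4 * e) + m * q)"
      if "0 \<le> a" "0 \<le> k" "0 \<le> b" "0 \<le> c" "0 \<le> d" "0 \<le> e" "0 \<le> m" "0 \<le> q" for a k b c d e m q :: real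
      using that by (simp add: ennreal_plus ennreal_mult)
    then show ?thesis unfolding C_def ennreal_of_nat_eq_real_of_nat using pos M by simp
  qed
  also have "\<dots> \<le> ennreal ((48 * \<kappa> * (2 + A) + 10 * A + 2 * A\<^sup>2) * (K\<^sup>2 * M / real n))"
  proof (rule ennreal_leI)
    \<comment> \<open>Lets the tail probability be absorbed in the main term. The final constant
      sums \<open>48 * \<kappa> * (2 + A)\<close> from the chi-squared part, \<open>4 * A\<close>
      twice from the remainder, and \<open>2 * A\<^sup>2 + 2 * A\<close> from the large
      samples.\<close>
    have n2: "M / (real n)\<^sup>2 \<le> K / real n"
      using n M by (intro frac_le) (auto simp: power2_eq_square)
    have 1: "48 * K * M * \<kappa> * ((K + 1) / real n + A * M / (real n)\<^sup>2)
        \<le> 48 * K * M * \<kappa> * ((2 + A) * (K / real n))"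
    proof (rule mult_left_mono)
      have "(K + 1) / real n \<le> 2 * (K / real n)" using M n by (simp add: field_simps)
      moreover have "A * (M / (real n)\<^sup>2) \<le> A * (K / real n)" by (intro mult_left_mono n2 pos)
      ultimately show "(K + 1) / real n + A * M / (real n)\<^sup>2 \<le> (2 + A) * (K / real n)"
        by (simp add: distrib_right add_divide_distrib)
    qed (use M pos in auto)
    have 2: "4 * M\<^sup>2 * (A * M / (real n)\<^sup>2) \<le> 4 * A * (K\<^sup>2 * M / real n)"
    proof -
      have "M\<^sup>2 * (A * M) / (real n)\<^sup>2 \<le> K\<^sup>2 * (A * M) / real n"
        using n M pos by (intro frac_le mult_right_mono power_mono) (auto simp: power2_eq_square)
      then have "4 * (M\<^sup>2 * (A * M) / (real n)\<^sup>2) \<le> 4 * (K\<^sup>2 * (A * M) / real n)" by simp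
      then show ?thesis by (simp add: ac_simps)
    qed
    have 3: "real n * (2 * (A + 1) * (A * K\<^sup>2 * M / (real n)\<^sup>2)) = (2 * A\<^sup>2 + 2 * A) * (K\<^sup>2 * M / real n)"
      using n by (simp add: field_simps power2_eq_square)
    have 4: "48 * K * M * \<kappa> * ((2 + A) * (K / real n)) = 48 * \<kappa> * (2 + A) * (K\<^sup>2 * M / real n)"
      by (simp add: power2_eq_square)
    have "48 * K * M * \<kappa> * ((K + 1) / real n + A * M / (real n)\<^sup>2)
        + (4 * M\<^sup>2 * (A * M / (real n)\<^sup>2) + 4 * (A * K\<^sup>2 * M / real n))
        + real n * (2 * (A + 1) * (A * K\<^sup>2 * M / (real n)\<^sup>2))
        \<le> 48 * \<kappa> * (2 + A) * (K\<^sup>2 * M / real n)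
        + (4 * A * (K\<^sup>2 * M / real n) + 4 * A * (K\<^sup>2 * M / real n)) + (2 * A\<^sup>2 + 2 * A) * (K\<^sup>2 * M / real n)"
      unfolding 3 by (intro add_mono 1[unfolded 4] 2) simp_all
    also have "\<dots> = (48 * \<kappa> * (2 + A) + 10 * A + 2 * A\<^sup>2) * (K\<^sup>2 * M / real n)"
      unfolding distrib_right[symmetric] by simp
    finally show "48 * K * M * \<kappa> * ((K + 1) / real n + A * M / (real n)\<^sup>2)
        + (4 * M\<^sup>2 * (A * M / (real n)\<^sup>2) + 4 * (A * K\<^sup>2 * M / real n))
        + real n * (2 * (A + 1) * (A * K\<^sup>2 * M / (real n)\<^sup>2)) \<le> \<dots>" .
  qed
  finally show ?thesis .
qed

section \<open>Existence and support of the minimum-distance estimator\<close>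

lemma tight_prob_on:
  assumes "\<And>k. Q k \<in> prob_on {0..B}" "0 \<le> B"
  shows "tight Q"
  unfolding tight_def
proof (intro conjI allI impI)
  show "real_distribution (Q k)" for k using assms(1) by (rule real_distribution_prob_on)
  fix \<epsilon> :: real assume "0 < \<epsilon>"
  \<comment> \<open>The intervals are open on the left, so they start below 0 to keep an atom at 0;
    this also leaves room when \<open>B = 0\<close>.\<close>
  have "measure (Q k) {-1<..B} > 1 - \<epsilon>" for k
  proof -
    interpret real_distribution "Q k" using assms(1) by (rule real_distribution_prob_on)
    have "prob {0..B} = 1" using assms(1)[of k] by (simp add: prob_on_def measure_def)
    moreover have "prob {0..B} \<le> prob {-1<..B}" by (rule finite_measure_mono) auto
    ultimately show ?thesis using \<open>0 < \<epsilon>\<close> by simp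
  qed
  then show "\<exists>a b. a < b \<and> (\<forall>k. measure (Q k) {a<..b} > 1 - \<epsilon>)"
    using assms(2) by (intro exI[of _ "-1"] exI[of _ B]) auto
qed

text \<open>Tightness gives a weak limit on the line. Two kinds of bounded continuous test functions
  do the rest: one that vanishes exactly on \<open>{0..B}\<close> pins the support, and the Poisson
  weights frozen outside that interval give the mixtures.\<close>

lemma prob_on_seq_compact:
  assumes Q: "\<And>k. Q k \<in> prob_on {0..B}" and B: "0 \<le> B"
  shows "\<exists>r \<mu>. strict_mono (r :: nat \<Rightarrow> nat) \<and> \<mu> \<in> prob_on {0..B} \<and>
    (\<forall>y. (\<lambda>k. poisson_mixture (Q (r k)) y) \<longlonglongrightarrow> poisson_mixture \<mu> y)"
proof -
  obtain r \<mu> where r: "strict_mono (r :: nat \<Rightarrow> nat)" "real_distribution \<mu>"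
    and w: "weak_conv_m (Q \<circ> id \<circ> r) \<mu>"
    using tight_imp_convergent_subsubsequence[OF tight_prob_on[of Q, OF Q B] strict_mono_id] by blast
  interpret \<mu>: real_distribution \<mu> by fact
  have lim: "(\<lambda>k. LINT x|Q (r k). f x) \<longlonglongrightarrow> (LINT x|\<mu>. f x)"
    if "\<And>x. isCont f x" "\<And>x. norm (f x) \<le> C" for f :: "real \<Rightarrow> real" and C
    using weak_conv_imp_integral_bdd_continuous_conv[OF _ r(2) w that] real_distribution_prob_on[OF Q]
    by simp
  define \<phi> where "\<phi> \<theta> = min 1 (max 0 (max (\<theta> - B) (- \<theta>)))" for \<theta> :: real
  have \<phi>: "0 \<le> \<phi> \<theta>" "\<phi> \<theta> \<le> 1" "\<phi> \<theta> = 0 \<longleftrightarrow> \<theta> \<in> {0..B}" for \<theta> by (auto simp: \<phi>_def)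
  have [measurable]: "\<phi> \<in> borel_measurable borel" unfolding \<phi>_def by measurable
  have "(\<lambda>k. LINT x|Q (r k). \<phi> x) \<longlonglongrightarrow> (LINT x|\<mu>. \<phi> x)"
    using \<phi> by (intro lim[of _ 1]) (auto simp: \<phi>_def intro!: continuous_intros)
  moreover have "(LINT x|Q (r k). \<phi> x) = 0" for k
    by (rule integral_eq_zero_AE) (use prob_on_AE[OF Q, of "r k"] \<phi>(3) in \<open>auto elim!: eventually_mono\<close>)
  ultimately have "(LINT x|\<mu>. \<phi> x) = 0" by (simp add: LIMSEQ_const_iff)
  moreover have "integrable \<mu> \<phi>"
    by (rule \<mu>.integrable_const_bound[where B = 1]) (use \<phi> in auto)
  ultimately have "AE \<theta> in \<mu>. \<phi> \<theta> = 0"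
    using integral_nonneg_eq_0_iff_AE[of \<mu> \<phi>] \<phi>(1) by simp
  then have \<mu>: "\<mu> \<in> prob_on {0..B}"
    by (intro prob_on_intro \<mu>.prob_space_axioms) (auto simp: \<phi>(3))
  \<comment> \<open>The weights are unbounded at negative arguments; clamping the argument to
    \<open>{0..B}\<close> makes them bounded and continuous without affecting priors that live
    there.\<close>
  have pm: "poisson_mixture P y
      = (LINT \<theta>|P. exp (- max 0 (min B \<theta>)) * (max 0 (min B \<theta>)) ^ y / fact y)"
    if P: "P \<in> prob_on {0..B}" for P y
  proof -
    have [measurable_cong]: "sets P = sets borel" using P by (simp add: prob_on_def)
    have "AE \<theta> in P. exp (- \<theta>) * \<theta> ^ y / fact y
        = exp (- max 0 (min B \<theta>)) * (max 0 (min B \<theta>)) ^ y / fact y"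
      using prob_on_AE[OF P] by eventually_elim simp
    then show ?thesis unfolding poisson_mixture_def by (intro integral_cong_AE) auto
  qed
  have "(\<lambda>k. poisson_mixture (Q (r k)) y) \<longlonglongrightarrow> poisson_mixture \<mu> y" for y
    unfolding pm[OF Q] pm[OF \<mu>]
  proof (rule lim[of _ 1])
    fix x :: real
    show "norm (exp (- max 0 (min B x)) * (max 0 (min B x)) ^ y / fact y) \<le> 1"
      using poisson_kernel_le_1[of "max 0 (min B x)" y] by simp
  qed (auto intro!: continuous_intros)
  then show ?thesis using r(1) \<mu> by (intro exI[of _ r] exI[of _ \<mu>]) simp
qed

text \<open>As a function of the parameter, the weight of \<open>y\<close> peaks at
  \<open>\<theta> = y\<close>. The estimate is \<open>1 + x < exp x\<close> at
  \<open>x = (\<theta> - B) / B\<close>, raised to the power \<open>y \<le> B\<close>.\<close>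

lemma poisson_kernel_strict_decreasing:
  fixes B \<theta> :: real
  assumes "real y \<le> B" "B < \<theta>"
  shows "exp (- \<theta>) * \<theta> ^ y / fact y < exp (- B) * B ^ y / fact y"
proof -
  have "\<theta> ^ y < exp (\<theta> - B) * B ^ y"
  proof (cases "y = 0")
    case True
    then show ?thesis using assms by simp
  next
    case False
    then have B: "0 < B" using assms by linarith
    have "\<theta> / B = 1 + (\<theta> - B) / B" using B by (simp add: field_simps)
    also have "\<dots> < exp ((\<theta> - B) / B)"
      using exp_minus_greater[of "- ((\<theta> - B) / B)"] assms B by simp
    finally have "(\<theta> / B) ^ y < exp ((\<theta> - B) / B) ^ y"
      using False assms B by (intro power_strict_mono) auto
    also have "\<dots> = exp (real y * ((\<theta> - B) / B))" by (simp only: exp_of_nat_mult)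
    also have "\<dots> \<le> exp (\<theta> - B)"
    proof -
      have "real y * (\<theta> - B) \<le> B * (\<theta> - B)" using assms by (intro mult_right_mono) auto
      then show ?thesis using B by (simp add: field_simps)
    qed
    finally show ?thesis using B by (simp add: field_simps)
  qed
  then have "exp (- \<theta>) * \<theta> ^ y < exp (- \<theta>) * (exp (\<theta> - B) * B ^ y)" by simp
  also have "\<dots> = exp (- B) * B ^ y" by (simp add: mult.assoc[symmetric] flip: exp_add)
  finally show ?thesis by (simp add: divide_strict_right_mono)
qed

text \<open>All mass beyond \<open>B\<close> moves to the point \<open>B\<close>. For
  \<open>y \<le> B\<close> every moved point then gives \<open>y\<close> a strictly larger
  weight.\<close>

lemma clamp_prob_on:
  assumes Q: "Q \<in> prob_on {0..}" and B: "0 \<le> B"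
  defines "Q' \<equiv> distr Q borel (min B)"
  shows "Q' \<in> prob_on {0..B}"
    and "real y \<le> B \<Longrightarrow> poisson_mixture Q y \<le> poisson_mixture Q' y"
    and "real y \<le> B \<Longrightarrow> Q \<notin> prob_on {0..B} \<Longrightarrow> poisson_mixture Q y < poisson_mixture Q' y"
proof -
  interpret Q: real_distribution Q using Q by (rule real_distribution_prob_on)
  show Q': "Q' \<in> prob_on {0..B}"
  proof (rule prob_on_intro)
    show "prob_space Q'" unfolding Q'_def by (rule Q.prob_space_distr) simp
    show "AE \<theta> in Q'. \<theta> \<in> {0..B}"
      unfolding Q'_def using prob_on_AE[OF Q] B by (subst AE_distr_iff) (auto elim!: eventually_mono)
  qed (auto simp: Q'_def)
  let ?k = "\<lambda>\<theta>::real. exp (- \<theta>) * \<theta> ^ y / fact y"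
  have pm': "poisson_mixture Q' y = (LINT \<theta>|Q. ?k (min B \<theta>))"
    unfolding poisson_mixture_def Q'_def by (subst integral_distr) auto
  have i: "integrable Q ?k" by (rule integrable_poisson_kernel[OF Q])
  have i': "integrable Q (\<lambda>\<theta>. ?k (min B \<theta>))"
    by (rule Q.integrable_const_bound[where B = 1])
       (use prob_on_AE[OF Q] B poisson_kernel_le_1[of "min B _"] in \<open>auto elim!: eventually_mono\<close>)
  assume y: "real y \<le> B"
  have k: "?k \<theta> \<le> ?k (min B \<theta>)" for \<theta>
    using poisson_kernel_strict_decreasing[OF y, of \<theta>] by (cases "\<theta> \<le> B") (auto simp: min_def)
  show le: "poisson_mixture Q y \<le> poisson_mixture Q' y"
    unfolding pm' unfolding poisson_mixture_def by (intro integral_mono i i' k)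
  assume nQ: "Q \<notin> prob_on {0..B}"
  have "poisson_mixture Q y \<noteq> poisson_mixture Q' y"
  proof
    assume "poisson_mixture Q y = poisson_mixture Q' y"
    \<comment> \<open>A nonnegative integrand with integral 0 vanishes almost everywhere, and strict
      decrease of the weight allows that only at \<open>\<theta> \<le> B\<close>.\<close>
    then have "(LINT \<theta>|Q. ?k (min B \<theta>) - ?k \<theta>) = 0"
      unfolding pm' using Bochner_Integration.integral_diff[OF i' i] by (simp add: poisson_mixture_def)
    then have "AE \<theta> in Q. ?k (min B \<theta>) - ?k \<theta> = 0"
      using integral_nonneg_eq_0_iff_AE[of Q "\<lambda>\<theta>. ?k (min B \<theta>) - ?k \<theta>"] i i' k by auto
    then have "AE \<theta> in Q. \<theta> \<in> {0..B}"
      using prob_on_AE[OF Q]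
    proof eventually_elim
      case (elim \<theta>)
      then show ?case
        using poisson_kernel_strict_decreasing[OF y, of \<theta>] by (cases "\<theta> \<le> B") (auto simp: min_def)
    qed
    then have "Q \<in> prob_on {0..B}" by (intro prob_on_intro Q.prob_space_axioms) auto
    then show False using nQ by simp
  qed
  then show "poisson_mixture Q y < poisson_mixture Q' y" using le by simp
qed

section \<open>The objective on a fixed sample and its minimizers\<close>

lemma return_prob_on: "c \<in> A \<Longrightarrow> A \<in> sets borel \<Longrightarrow> return borel (c::real) \<in> prob_on A"
  by (simp add: prob_on_def prob_space_return)

lemma poisson_mixture_return:
  "poisson_mixture (return borel c) y = exp (- c) * c ^ y / fact y"
  unfolding poisson_mixture_def by (subst integral_return) auto

text \<open>Extended addition fails to be continuous only where infinities of opposite sign meet, so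
  \<open>- \<infinity>\<close> is excluded and the exclusion carried through the induction. The
  value \<open>\<infinity>\<close> has to be allowed: a limit prior may give mass 0 to an observed
  value.\<close>

lemma tendsto_sum_ereal_not_MInfty:
  fixes f :: "'a \<Rightarrow> nat \<Rightarrow> ereal"
  assumes "finite S" "\<And>y. y \<in> S \<Longrightarrow> f y \<longlonglongrightarrow> l y" "\<And>y. y \<in> S \<Longrightarrow> l y \<noteq> - \<infinity>"
  shows "(\<lambda>k. \<Sum>y\<in>S. f y k) \<longlonglongrightarrow> (\<Sum>y\<in>S. l y) \<and> (\<Sum>y\<in>S. l y) \<noteq> - \<infinity>"
  using assms
proof (induction S rule: finite_induct)
  case (insert x S)
  then have "(\<lambda>k. f x k + (\<Sum>y\<in>S. f y k)) \<longlonglongrightarrow> l x + (\<Sum>y\<in>S. l y)"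
    by (intro tendsto_add_ereal_nonneg) auto
  then show ?case using insert by (auto simp: ereal_plus_eq_MInfty)
qed simp

text \<open>On a sample, only the finitely many observed values contribute, since \<open>loss 0 b = 0\<close>.\<close>

definition empirical_loss ::
    "(nat pmf \<Rightarrow> nat pmf \<Rightarrow> ennreal) \<Rightarrow> (real \<Rightarrow> real \<Rightarrow> ereal) \<Rightarrow> (nat list \<Rightarrow> real) \<Rightarrow> bool" where
  "empirical_loss dst loss T \<longleftrightarrow>
    (\<forall>a\<ge>0. \<forall>b\<ge>0. loss a b \<noteq> - \<infinity>) \<and>
    (\<forall>a\<ge>0. \<forall>b>0. loss a b \<noteq> \<infinity>) \<and>
    (\<forall>a>0. \<forall>b1\<ge>0. \<forall>b2>b1. loss a b2 < loss a b1) \<and>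
    (\<forall>a>0. continuous_on {0..} (loss a)) \<and>
    (\<forall>ys Q. ys \<noteq> [] \<longrightarrow> Q \<in> prob_on {0..} \<longrightarrow>
       enn2ereal (dst (empirical ys) (mixture_pmf Q))
         = ereal (T ys) + (\<Sum>y\<in>set ys. loss (pmf (empirical ys) y) (poisson_mixture Q y)))"

lemma empirical_lossD:
  assumes "empirical_loss dst loss T"
  shows "0 \<le> a \<Longrightarrow> 0 \<le> b \<Longrightarrow> loss a b \<noteq> - \<infinity>"
    and "0 \<le> a \<Longrightarrow> 0 < b \<Longrightarrow> loss a b \<noteq> \<infinity>"
    and "0 < a \<Longrightarrow> 0 \<le> b1 \<Longrightarrow> b1 < b2 \<Longrightarrow> loss a b2 < loss a b1"
    and "0 < a \<Longrightarrow> continuous_on {0..} (loss a)"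
    and "ys \<noteq> [] \<Longrightarrow> Q \<in> prob_on {0..} \<Longrightarrow>
       enn2ereal (dst (empirical ys) (mixture_pmf Q))
         = ereal (T ys) + (\<Sum>y\<in>set ys. loss (pmf (empirical ys) y) (poisson_mixture Q y))"
  using assms unfolding empirical_loss_def by blast+

lemma decomposable_empirical_loss:
  assumes "decomposable dst"
  shows "\<exists>loss T. empirical_loss dst loss T"
proof -
  obtain t :: "nat pmf \<Rightarrow> real" and loss :: "real \<Rightarrow> real \<Rightarrow> ereal" where
      1: "\<forall>a\<ge>0. \<forall>b\<ge>0. loss a b \<noteq> - \<infinity>"
    and 2: "\<forall>a\<ge>0. \<forall>b>0. loss a b \<noteq> \<infinity>"
    and 3: "\<forall>q1 q2. \<exists>S. (\<lambda>y. loss (pmf q1 y) (pmf q2 y)) sums S \<and>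
         enn2ereal (dst q1 q2) = ereal (t q1) + S"
    and 4: "\<forall>a>0. \<forall>b1\<ge>0. \<forall>b2>b1. loss a b2 < loss a b1"
    and 5: "\<forall>a>0. continuous_on {0..} (loss a)"
    and 6: "\<forall>b\<ge>0. loss 0 b = 0"
    using assms unfolding decomposable_def by (elim exE conjE)
  have 7: "enn2ereal (dst (empirical ys) (mixture_pmf Q))
         = ereal (t (empirical ys)) + (\<Sum>y\<in>set ys. loss (pmf (empirical ys) y) (poisson_mixture Q y))"
    if ys: "ys \<noteq> []" and Q: "Q \<in> prob_on {0..}" for ys Q
  proof -
    obtain S where S: "(\<lambda>y. loss (pmf (empirical ys) y) (poisson_mixture Q y)) sums S"
      "enn2ereal (dst (empirical ys) (mixture_pmf Q)) = ereal (t (empirical ys)) + S"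
      using 3[rule_format, of "empirical ys" "mixture_pmf Q"] by (auto simp: pmf_mixture_pmf[OF Q])
    have "pmf (empirical ys) y = 0" if "y \<notin> set ys" for y
      using that ys by (simp add: empirical_def count_mset_0_iff)
    then have "(\<lambda>y. loss (pmf (empirical ys) y) (poisson_mixture Q y))
        sums (\<Sum>y\<in>set ys. loss (pmf (empirical ys) y) (poisson_mixture Q y))"
      using 6 ennreal_poisson_mixture(2)[OF Q] by (intro sums_finite) auto
    then show ?thesis using S sums_unique2 by blast
  qed
  show ?thesis unfolding empirical_loss_def
    by (intro exI[of _ loss] exI[of _ "\<lambda>ys. t (empirical ys)"] conjI 1 2 4 5) (use 7 in auto)
qed

lemma pmf_empirical_pos: "y \<in> set ys \<Longrightarrow> 0 < pmf (empirical ys) y"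
  by (cases "ys = []") (auto simp: empirical_def)

text \<open>Direct method: a minimizing sequence, a subsequence whose mixtures converge pointwise,
  and continuity of the loss up to \<open>b = 0\<close>, infinite values included.\<close>

lemma exists_min_dist_bounded:
  assumes dec: "decomposable dst" and ys: "ys \<noteq> []" and B: "0 \<le> B"
  shows "\<exists>\<mu>\<in>prob_on {0..B}. \<forall>Q\<in>prob_on {0..B}.
    dst (empirical ys) (mixture_pmf \<mu>) \<le> dst (empirical ys) (mixture_pmf Q)"
proof -
  obtain loss T where "empirical_loss dst loss T"
    using decomposable_empirical_loss[OF dec] by blast
  note l = empirical_lossD(1)[OF this] and fin = empirical_lossD(2)[OF this]
    and mono = empirical_lossD(3)[OF this] and cont = empirical_lossD(4)[OF this]
    and eq = empirical_lossD(5)[OF this]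
  let ?F = "\<lambda>Q. dst (empirical ys) (mixture_pmf Q)"
  have sub: "Q \<in> prob_on {0..}" if "Q \<in> prob_on {0..B}" for Q
    using that by (rule prob_on_mono) auto
  have "?F ` prob_on {0..B} \<noteq> {}" using return_prob_on[of 0 "{0..B}"] B by auto
  then obtain f where f: "decseq f" "range f \<subseteq> ?F ` prob_on {0..B}" "Inf (?F ` prob_on {0..B}) = (INF i. f i)"
    using ennreal_Inf_countable_INF[of "?F ` prob_on {0..B}"] by blast
  then have "\<forall>i. \<exists>Q. Q \<in> prob_on {0..B} \<and> f i = ?F Q" by auto
  then obtain Q where "\<forall>i. Q i \<in> prob_on {0..B} \<and> f i = ?F (Q i)" by (rule choice[THEN exE])
  then have Q: "\<And>i. Q i \<in> prob_on {0..B}" "\<And>i. f i = ?F (Q i)" by auto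
  obtain r \<mu> where "strict_mono (r :: nat \<Rightarrow> nat) \<and> \<mu> \<in> prob_on {0..B} \<and>
    (\<forall>y. (\<lambda>k. poisson_mixture (Q (r k)) y) \<longlonglongrightarrow> poisson_mixture \<mu> y)"
    using prob_on_seq_compact[of Q, OF Q(1) B] by (elim exE)
  then have r: "strict_mono r" and \<mu>: "\<mu> \<in> prob_on {0..B}"
    and lim: "\<And>y. (\<lambda>k. poisson_mixture (Q (r k)) y) \<longlonglongrightarrow> poisson_mixture \<mu> y"
    by simp_all
  have nn: "0 \<le> poisson_mixture P y" if "P \<in> prob_on {0..B}" for P y
    by (rule ennreal_poisson_mixture(2)[OF sub[OF that]])
  let ?S = "\<lambda>P. \<Sum>y\<in>set ys. loss (pmf (empirical ys) y) (poisson_mixture P y)"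
  have "(\<lambda>k. ?S (Q (r k))) \<longlonglongrightarrow> ?S \<mu> \<and> ?S \<mu> \<noteq> - \<infinity>"
  proof (rule tendsto_sum_ereal_not_MInfty)
    fix y assume y: "y \<in> set ys"
    show "(\<lambda>k. loss (pmf (empirical ys) y) (poisson_mixture (Q (r k)) y))
        \<longlonglongrightarrow> loss (pmf (empirical ys) y) (poisson_mixture \<mu> y)"
      by (rule continuous_on_tendsto_compose[OF cont lim]) (use pmf_empirical_pos[OF y] nn Q \<mu> in auto)
  qed (use l nn \<mu> in auto)
  then have "(\<lambda>k. ereal (T ys) + ?S (Q (r k))) \<longlonglongrightarrow> ereal (T ys) + ?S \<mu>"
    by (intro tendsto_add_ereal_nonneg) auto
  then have "(\<lambda>k. ?F (Q (r k))) \<longlonglongrightarrow> ?F \<mu>"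
    using eq[OF ys sub[OF \<mu>]] eq[OF ys sub[OF Q(1)]] by (subst tendsto_enn2ereal_iff[symmetric]) simp
  moreover have "(\<lambda>k. ?F (Q (r k))) \<longlonglongrightarrow> (INF i. f i)"
    using LIMSEQ_subseq_LIMSEQ[OF LIMSEQ_INF[OF f(1)] r] by (simp add: o_def Q(2))
  ultimately have "?F \<mu> = Inf (?F ` prob_on {0..B})"
    using f(3) LIMSEQ_unique by simp
  then show ?thesis using \<mu> by (intro bexI[of _ \<mu>]) (auto intro: INF_lower)
qed

text \<open>All observed values are at most \<open>Y\<close>, so clamping lowers no mass that enters
  the objective, and the loss decreases in the mass. Finiteness gives room for strictness: an
  infinite objective might stay infinite.\<close>

lemma dst_clamp:
  assumes dec: "decomposable dst" and ys: "ys \<noteq> []" and Q: "Q \<in> prob_on {0..}"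
  defines "Y \<equiv> real (Max (set ys))"
  shows "dst (empirical ys) (mixture_pmf (distr Q borel (min Y))) \<le> dst (empirical ys) (mixture_pmf Q)"
    and "Q \<notin> prob_on {0..Y} \<Longrightarrow> dst (empirical ys) (mixture_pmf Q) \<noteq> \<infinity> \<Longrightarrow>
      dst (empirical ys) (mixture_pmf (distr Q borel (min Y))) < dst (empirical ys) (mixture_pmf Q)"
proof -
  obtain loss T where "empirical_loss dst loss T"
    using decomposable_empirical_loss[OF dec] by blast
  note l = empirical_lossD(1)[OF this] and fin = empirical_lossD(2)[OF this]
    and mono = empirical_lossD(3)[OF this] and cont = empirical_lossD(4)[OF this]
    and eq = empirical_lossD(5)[OF this]
  let ?Q = "distr Q borel (min Y)"
  have Y: "0 \<le> Y" by (simp add: Y_def)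
  have yY: "real y \<le> Y" if "y \<in> set ys" for y using that by (simp add: Y_def)
  note c = clamp_prob_on[OF Q Y]
  have Q': "?Q \<in> prob_on {0..}" using c(1) by (rule prob_on_mono) auto
  let ?l = "\<lambda>P y. loss (pmf (empirical ys) y) (poisson_mixture P y)"
  have lt: "?l ?Q y < ?l Q y" if "y \<in> set ys" "poisson_mixture Q y < poisson_mixture ?Q y" for y
    using mono[OF pmf_empirical_pos] that ennreal_poisson_mixture(2)[OF Q] by auto
  have le: "?l ?Q y \<le> ?l Q y" if "y \<in> set ys" for y
    using lt[OF that] c(2)[OF yY[OF that]] by (cases "poisson_mixture Q y = poisson_mixture ?Q y") auto
  show "dst (empirical ys) (mixture_pmf ?Q) \<le> dst (empirical ys) (mixture_pmf Q)"
    unfolding less_eq_ennreal.rep_eq eq[OF ys Q] eq[OF ys Q']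
    by (intro add_left_mono sum_mono le)
  assume nQ: "Q \<notin> prob_on {0..Y}" and fin': "dst (empirical ys) (mixture_pmf Q) \<noteq> \<infinity>"
  have "enn2ereal (dst (empirical ys) (mixture_pmf Q)) \<noteq> \<infinity>"
    using fin' by simp
  then have "(\<Sum>y\<in>set ys. ?l Q y) \<noteq> \<infinity>" unfolding eq[OF ys Q] by auto
  then have fQ: "?l Q y \<noteq> \<infinity>" if "y \<in> set ys" for y using that by (auto simp: sum_Pinfty)
  have gQ: "?l Q y \<noteq> - \<infinity>" "?l ?Q y \<noteq> - \<infinity>" for y
    using l ennreal_poisson_mixture(2)[OF Q] ennreal_poisson_mixture(2)[OF Q'] by auto
  have strict: "?l ?Q y < ?l Q y" if "y \<in> set ys" for y using lt[OF that c(3)[OF yY[OF that] nQ]] .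
  \<comment> \<open>All terms are finite: those of \<open>Q\<close> because the objective is, those
    of the clamped prior because they are strictly smaller and not \<open>- \<infinity>\<close>.
    Over the reals strict inequalities survive summation.\<close>
  define a b where "a y = real_of_ereal (?l ?Q y)" and "b y = real_of_ereal (?l Q y)" for y
  have ab: "?l ?Q y = ereal (a y)" "?l Q y = ereal (b y)" if "y \<in> set ys" for y
  proof -
    show "?l ?Q y = ereal (a y)"
      using gQ(2)[of y] strict[OF that] unfolding a_def by (cases "?l ?Q y") auto
    show "?l Q y = ereal (b y)"
      using fQ[OF that] gQ(1)[of y] unfolding b_def by (cases "?l Q y") auto
  qed
  have "a y < b y" if "y \<in> set ys" for y using strict[OF that] unfolding ab[OF that] by simp
  then have lt_sum: "(\<Sum>y\<in>set ys. a y) < (\<Sum>y\<in>set ys. b y)"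
    using ys by (intro sum_strict_mono) auto
  have "(\<Sum>y\<in>set ys. ?l ?Q y) = (\<Sum>y\<in>set ys. ereal (a y))" by (rule sum.cong[OF refl ab(1)])
  moreover have "(\<Sum>y\<in>set ys. ?l Q y) = (\<Sum>y\<in>set ys. ereal (b y))" by (rule sum.cong[OF refl ab(2)])
  ultimately show "dst (empirical ys) (mixture_pmf ?Q) < dst (empirical ys) (mixture_pmf Q)"
    unfolding less_ennreal.rep_eq eq[OF ys Q] eq[OF ys Q'] using lt_sum by (simp only: sum_ereal) simp
qed

text \<open>\<open>ARG_MIN\<close> is a bare choice; it is the existence hypothesis that turns the
  chosen value into a minimizer.\<close>

lemma is_arg_min_min_dist_estimator:
  assumes "\<exists>\<mu>\<in>prob_on \<Theta>. \<forall>Q\<in>prob_on \<Theta>. dst (empirical ys) (mixture_pmf \<mu>) \<le> dst (empirical ys) (mixture_pmf Q)"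
  shows "min_dist_estimator dst \<Theta> ys \<in> prob_on \<Theta>"
    and "Q \<in> prob_on \<Theta> \<Longrightarrow>
      dst (empirical ys) (mixture_pmf (min_dist_estimator dst \<Theta> ys)) \<le> dst (empirical ys) (mixture_pmf Q)"
proof -
  have "is_arg_min (\<lambda>Q. dst (empirical ys) (mixture_pmf Q)) (\<lambda>Q. Q \<in> prob_on \<Theta>) (min_dist_estimator dst \<Theta> ys)"
    unfolding min_dist_estimator_def arg_min_def
    by (rule someI_ex) (use assms in \<open>auto simp: is_arg_min_def not_less\<close>)
  then show "min_dist_estimator dst \<Theta> ys \<in> prob_on \<Theta>"
    and "Q \<in> prob_on \<Theta> \<Longrightarrow>
      dst (empirical ys) (mixture_pmf (min_dist_estimator dst \<Theta> ys)) \<le> dst (empirical ys) (mixture_pmf Q)"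
    by (auto simp: is_arg_min_def not_less)
qed

text \<open>Clamping at the largest observation never raises the objective, so the minimizer from
  the compact case beats every prior on \<open>{0..}\<close>.\<close>

lemma exists_min_dist_unbounded:
  assumes dec: "decomposable dst" and ys: "ys \<noteq> []"
  shows "\<exists>\<mu>\<in>prob_on {0..}. \<forall>Q\<in>prob_on {0..}.
    dst (empirical ys) (mixture_pmf \<mu>) \<le> dst (empirical ys) (mixture_pmf Q)"
proof -
  define Y where "Y = real (Max (set ys))"
  have Y: "0 \<le> Y" by (simp add: Y_def)
  obtain \<mu> where \<mu>: "\<mu> \<in> prob_on {0..Y}" and min: "\<And>Q. Q \<in> prob_on {0..Y} \<Longrightarrow>
      dst (empirical ys) (mixture_pmf \<mu>) \<le> dst (empirical ys) (mixture_pmf Q)"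
    using exists_min_dist_bounded[OF dec ys Y] by blast
  have "dst (empirical ys) (mixture_pmf \<mu>) \<le> dst (empirical ys) (mixture_pmf Q)"
    if Q: "Q \<in> prob_on {0..}" for Q
    using min[OF clamp_prob_on(1)[OF Q Y]] dst_clamp(1)[OF dec ys Q] by (simp add: Y_def)
  moreover have "\<mu> \<in> prob_on {0..}" using \<mu> by (rule prob_on_mono) auto
  ultimately show ?thesis by blast
qed

text \<open>This concerns whichever minimizer is chosen, not the one built in the existence proof,
  hence the strict form of clamping: a minimizer with mass beyond the largest observation could be
  improved.\<close>

lemma min_dist_estimator_support:
  assumes dec: "decomposable dst" and ys: "ys \<noteq> []"
  shows "min_dist_estimator dst {0..} ys \<in> prob_on {0..real (Max (set ys))}"
proof (rule ccontr)
  let ?Q = "min_dist_estimator dst {0..} ys"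
  assume n: "?Q \<notin> prob_on {0..real (Max (set ys))}"
  note m = is_arg_min_min_dist_estimator[where dst = dst and ys = ys and \<Theta> = "{0..}", OF exists_min_dist_unbounded[OF dec ys]]
  obtain loss T where "empirical_loss dst loss T"
    using decomposable_empirical_loss[OF dec] by blast
  note l = empirical_lossD(1)[OF this] and fin = empirical_lossD(2)[OF this]
    and mono = empirical_lossD(3)[OF this] and cont = empirical_lossD(4)[OF this]
    and eq = empirical_lossD(5)[OF this]
  \<comment> \<open>The point mass at 1 charges every integer, so its objective is finite, and so is
    the minimum.\<close>
  have P: "return borel 1 \<in> prob_on {0..}" by (rule return_prob_on) auto
  have "enn2ereal (dst (empirical ys) (mixture_pmf (return borel 1))) \<noteq> \<infinity>"
    unfolding eq[OF ys P] poisson_mixture_return using fin by (auto simp: sum_Pinfty)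
  then have "dst (empirical ys) (mixture_pmf (return borel 1)) \<noteq> \<infinity>"
    by simp
  then have "dst (empirical ys) (mixture_pmf ?Q) \<noteq> \<infinity>"
    using m(2)[OF P] by (auto simp: top_unique)
  then have "dst (empirical ys) (mixture_pmf (distr ?Q borel (min (real (Max (set ys)))))) < dst (empirical ys) (mixture_pmf ?Q)"
    by (intro dst_clamp(2)[OF dec ys m(1)] n)
  moreover have "distr ?Q borel (min (real (Max (set ys)))) \<in> prob_on {0..}"
    using clamp_prob_on(1)[OF m(1), of "real (Max (set ys))"] by (rule prob_on_mono[rotated 0]) auto
  ultimately show False using m(2) by (auto simp: not_le[symmetric])
qed

section \<open>Tail bounds\<close>

text \<open>Both mixtures lie within \<open>\<kappa>2 / \<kappa>1\<close> times the divergence from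
  \<open>p\<close>, the fitted one by minimality; the relaxed triangle inequality contributes 2 +
  2.\<close>

lemma hellinger_min_dist_le:
  assumes sw: "sandwiched \<kappa>1 \<kappa>2 dst" and pos: "0 < \<kappa>1" "0 < \<kappa>2"
    and le: "dst p (mixture_pmf Q) \<le> dst p (mixture_pmf G)"
  shows "hellinger_sq (mixture_pmf G) (mixture_pmf Q) \<le> ennreal (4 * \<kappa>2 / \<kappa>1) * chi_sq p (mixture_pmf G)"
proof -
  let ?c = "ennreal \<kappa>2 * chi_sq p (mixture_pmf G)"
  have G: "ennreal \<kappa>1 * hellinger_sq p (mixture_pmf G) \<le> ?c"
    and Q: "ennreal \<kappa>1 * hellinger_sq p (mixture_pmf Q) \<le> ?c"
    using sw le unfolding sandwiched_def by (meson order_trans)+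
  have "ennreal \<kappa>1 * hellinger_sq (mixture_pmf G) (mixture_pmf Q)
      \<le> ennreal \<kappa>1 * (2 * hellinger_sq p (mixture_pmf G) + 2 * hellinger_sq p (mixture_pmf Q))"
    by (intro mult_left_mono hellinger_sq_triangle) auto
  also have "\<dots> = 2 * (ennreal \<kappa>1 * hellinger_sq p (mixture_pmf G)) + 2 * (ennreal \<kappa>1 * hellinger_sq p (mixture_pmf Q))"
    by (simp add: distrib_left ac_simps)
  also have "\<dots> \<le> 2 * ?c + 2 * ?c"
    by (intro add_mono mult_left_mono G Q) auto
  also have "\<dots> = (2 + 2) * ?c" by (simp only: distrib_right)
  also have "\<dots> = 4 * ?c" by simp
  finally have "ennreal (1 / \<kappa>1) * (ennreal \<kappa>1 * hellinger_sq (mixture_pmf G) (mixture_pmf Q)) \<le> ennreal (1 / \<kappa>1) * (4 * ?c)"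
    by (rule mult_left_mono) simp
  moreover have "ennreal (1 / \<kappa>1) * ennreal \<kappa>1 = 1"
    using pos by (subst ennreal_mult[symmetric]) auto
  moreover have "ennreal (1 / \<kappa>1) * (4 * ?c) = ennreal (4 * \<kappa>2 / \<kappa>1) * chi_sq p (mixture_pmf G)"
  proof -
    have "4 * ennreal \<kappa>2 = ennreal (4 * \<kappa>2)" using pos by (simp add: ennreal_mult)
    moreover have "ennreal (1 / \<kappa>1) * ennreal (4 * \<kappa>2) = ennreal (4 * \<kappa>2 / \<kappa>1)"
      using pos by (subst ennreal_mult[symmetric]) auto
    ultimately show ?thesis by (metis mult.assoc)
  qed
  ultimately show ?thesis by (simp add: mult.assoc[symmetric])
qed

section \<open>Truncated second moments from exponential moments\<close>

lemma sq_le_exp: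
  fixes x b :: real
  assumes "0 \<le> x" "0 < b"
  shows "x\<^sup>2 \<le> 2 / b\<^sup>2 * exp (b * x)"
proof -
  have "(b * x)\<^sup>2 / 2 \<le> exp (b * x)"
  proof -
    have "0 \<le> b * x" using assms by simp
    then show ?thesis using exp_lower_Taylor_quadratic[of "b * x"] by linarith
  qed
  then show ?thesis using assms by (simp add: field_simps power_mult_distrib)
qed

text \<open>The rate \<open>a\<close> is split: \<open>b\<close> pays for the square and
  \<open>a - b\<close> is left for the decay in \<open>K\<close>.\<close>

lemma sq_tail_le_exp:
  fixes x a b K :: real
  assumes "0 \<le> x" "0 < b" "b \<le> a" "K \<le> x"
  shows "x\<^sup>2 \<le> 2 / b\<^sup>2 * exp (- (a - b) * K) * exp (a * x)"
proof -
  have "x\<^sup>2 \<le> 2 / b\<^sup>2 * exp (b * x)" using assms by (intro sq_le_exp) auto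
  also have "\<dots> \<le> 2 / b\<^sup>2 * (exp (- (a - b) * K) * exp (a * x))"
  proof (rule mult_left_mono)
    have "(a - b) * K \<le> (a - b) * x" using assms by (intro mult_left_mono) auto
    then show "exp (b * x) \<le> exp (- (a - b) * K) * exp (a * x)"
      by (simp add: algebra_simps flip: exp_add)
  qed simp
  finally show ?thesis by (simp add: mult.assoc)
qed

text \<open>A general \<open>X\<close> serves both observations and posterior means. With
  \<open>a = b\<close> and a negative \<open>K\<close> the whole second moment is bounded.\<close>

lemma nn_integral_sq_tail_le:
  fixes X :: "nat \<Rightarrow> real"
  assumes "\<And>y. 0 \<le> X y" "0 < b" "b \<le> a"
    and E: "(\<integral>\<^sup>+ y. ennreal (exp (a * X y)) \<partial>measure_pmf p) \<le> ennreal C" and C: "0 \<le> C"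
  shows "(\<integral>\<^sup>+ y. ennreal ((X y)\<^sup>2) * indicator {y. K < X y} y \<partial>measure_pmf p)
    \<le> ennreal (2 / b\<^sup>2 * exp (- (a - b) * K) * C)"
proof -
  have "(\<integral>\<^sup>+ y. ennreal ((X y)\<^sup>2) * indicator {y. K < X y} y \<partial>measure_pmf p)
      \<le> (\<integral>\<^sup>+ y. ennreal (2 / b\<^sup>2 * exp (- (a - b) * K)) * ennreal (exp (a * X y)) \<partial>measure_pmf p)"
  proof (rule nn_integral_mono)
    fix y
    show "ennreal ((X y)\<^sup>2) * indicator {y. K < X y} y
      \<le> ennreal (2 / b\<^sup>2 * exp (- (a - b) * K)) * ennreal (exp (a * X y))"
    proof (cases "K < X y")
      case True
      then have "(X y)\<^sup>2 \<le> 2 / b\<^sup>2 * exp (- (a - b) * K) * exp (a * X y)"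
        using assms by (intro sq_tail_le_exp) auto
      then have "ennreal ((X y)\<^sup>2) \<le> ennreal (2 / b\<^sup>2 * exp (- (a - b) * K) * exp (a * X y))"
        by (rule ennreal_leI)
      also have "\<dots> = ennreal (2 / b\<^sup>2 * exp (- (a - b) * K)) * ennreal (exp (a * X y))"
        by (rule ennreal_mult) auto
      finally show ?thesis using True by simp
    qed simp
  qed
  also have "\<dots> = ennreal (2 / b\<^sup>2 * exp (- (a - b) * K)) * (\<integral>\<^sup>+ y. ennreal (exp (a * X y)) \<partial>measure_pmf p)"
    by (rule nn_integral_cmult) simp
  also have "\<dots> \<le> ennreal (2 / b\<^sup>2 * exp (- (a - b) * K)) * ennreal C"
    by (intro mult_left_mono E) auto
  also have "\<dots> = ennreal (2 / b\<^sup>2 * exp (- (a - b) * K) * C)"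
    using C by (intro ennreal_mult[symmetric]) auto
  finally show ?thesis .
qed

lemma mixture_exp_moment_bounded:
  assumes G: "G \<in> prob_on {0..h}" and a: "0 \<le> a"
  shows "(\<integral>\<^sup>+ y. ennreal (exp (a * real y)) \<partial>measure_pmf (mixture_pmf G)) \<le> ennreal (exp (h * (exp a - 1)))"
proof -
  interpret prob_space G using G by (simp add: prob_on_def)
  have "G \<in> prob_on {0..}" using G by (rule prob_on_mono) auto
  then have "(\<integral>\<^sup>+ y. ennreal (exp (a * real y)) \<partial>measure_pmf (mixture_pmf G))
      = (\<integral>\<^sup>+ \<theta>. ennreal (exp (\<theta> * (exp a - 1))) \<partial>G)"
    by (rule nn_integral_mixture_exp)
  also have "\<dots> \<le> (\<integral>\<^sup>+ \<theta>. ennreal (exp (h * (exp a - 1))) \<partial>G)"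
    by (rule nn_integral_mono_AE, use prob_on_AE[OF G] in eventually_elim)
       (use a in \<open>auto intro!: ennreal_leI mult_right_mono\<close>)
  also have "\<dots> = ennreal (exp (h * (exp a - 1)))" by (simp add: emeasure_space_1)
  finally show ?thesis .
qed

text \<open>Slicing at multiples of \<open>s\<close>: between \<open>k * s\<close> and
  \<open>(k + 1) * s\<close> the exponential is at most \<open>exp ((k + 1) / 2)\<close>, while the
  tail at \<open>k * s\<close> is at most \<open>2 * exp (- k)\<close>. Taking half the tail rate
  leaves a geometric series of ratio \<open>exp (-1/2)\<close>, whose sum is independent of
  \<open>s\<close>.\<close>

lemma subexp_exp_moment:
  assumes G: "G \<in> SubE s" and s: "0 < s"
  shows "(\<integral>\<^sup>+ \<theta>. ennreal (exp (1 / (2 * s) * \<theta>)) \<partial>G) \<le> ennreal (2 * exp (1/2) / (1 - exp (-1/2)))"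
proof -
  have G0: "G \<in> prob_on {0..}" and tail: "\<And>t. 0 < t \<Longrightarrow> measure G {t..} \<le> 2 * exp (- t / s)"
    using G by (auto simp: SubE_def)
  interpret real_distribution G using G0 by (rule real_distribution_prob_on)
  have tail': "emeasure G {real k * s..} \<le> ennreal (2 * exp (- real k))" for k
  \<comment> \<open>The tail hypothesis covers positive \<open>t\<close> only; at 0 the bound 2
    holds because it exceeds the total mass.\<close>
  proof (cases "k = 0")
    case True
    then show ?thesis using order_trans[OF emeasure_le_1[of "{real k * s..}"], of "ennreal 2"] by simp
  next
    case False
    then show ?thesis using tail[of "real k * s"] s by (simp add: emeasure_eq_measure ennreal_leI)
  qed
  have "(\<integral>\<^sup>+ \<theta>. ennreal (exp (1 / (2 * s) * \<theta>)) \<partial>G)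
      \<le> (\<integral>\<^sup>+ \<theta>. (\<Sum>k. ennreal (exp ((real k + 1) / 2)) * indicator {real k * s..} \<theta>) \<partial>G)"
  proof (rule nn_integral_mono_AE, use prob_on_AE[OF G0] in eventually_elim)
    fix \<theta> :: real assume "\<theta> \<in> {0..}"
    define k where "k = nat \<lfloor>\<theta> / s\<rfloor>"
    have k: "real k \<le> \<theta> / s" "\<theta> / s \<le> real k + 1"
      using \<open>\<theta> \<in> {0..}\<close> s unfolding k_def by (auto simp: of_nat_nat)
    have "ennreal (exp (1 / (2 * s) * \<theta>)) \<le> ennreal (exp ((real k + 1) / 2))"
      using k s by (intro ennreal_leI) (simp add: field_simps)
    also have "\<dots> = (\<Sum>k\<in>{k}. ennreal (exp ((real k + 1) / 2)) * indicator {real k * s..} \<theta>)"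
      using k s by (simp add: field_simps)
    also have "\<dots> \<le> (\<Sum>k. ennreal (exp ((real k + 1) / 2)) * indicator {real k * s..} \<theta>)"
      by (rule sum_le_suminf) auto
    finally show "ennreal (exp (1 / (2 * s) * \<theta>)) \<le> \<dots>" .
  qed
  also have "\<dots> = (\<Sum>k. ennreal (exp ((real k + 1) / 2)) * emeasure G {real k * s..})"
    by (subst nn_integral_suminf) (auto simp: nn_integral_cmult_indicator)
  also have "\<dots> \<le> (\<Sum>k. ennreal (2 * exp (1/2) * exp (-1/2) ^ k))"
  proof (rule suminf_le)
    fix k
    have "ennreal (exp ((real k + 1) / 2)) * emeasure G {real k * s..}
        \<le> ennreal (exp ((real k + 1) / 2)) * ennreal (2 * exp (- real k))"
      by (intro mult_left_mono tail') auto
    also have "\<dots> = ennreal (exp ((real k + 1) / 2) * (2 * exp (- real k)))"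
      by (rule ennreal_mult[symmetric]) auto
    also have "exp ((real k + 1) / 2) * (2 * exp (- real k)) = 2 * exp (1/2) * exp (-1/2) ^ k"
      by (simp add: field_simps flip: exp_of_nat_mult exp_add)
    finally show "ennreal (exp ((real k + 1) / 2)) * emeasure G {real k * s..}
        \<le> ennreal (2 * exp (1/2) * exp (-1/2) ^ k)" .
  qed auto
  also have "\<dots> = ennreal (2 * exp (1/2) * (1 / (1 - exp (-1/2))))"
    by (rule suminf_ennreal_eq[OF _ sums_mult[OF geometric_sums]]) auto
  finally show ?thesis by simp
qed

text \<open>Poisson noise turns the rate \<open>a\<close> into \<open>exp a - 1\<close> on the
  prior. For \<open>a = 1 / (4 * s) \<le> 1\<close> this is at most \<open>2 * a\<close>, the rate
  \<open>1 / (2 * s)\<close> available for the prior; \<open>1 \<le> s\<close> keeps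
  \<open>a\<close> in that range.\<close>

lemma subexp_mixture_exp_moment:
  assumes G: "G \<in> SubE s" and s: "1 \<le> s"
  shows "(\<integral>\<^sup>+ y. ennreal (exp (1 / (4 * s) * real y)) \<partial>measure_pmf (mixture_pmf G))
    \<le> ennreal (2 * exp (1/2) / (1 - exp (-1/2)))"
proof -
  have G0: "G \<in> prob_on {0..}" using G by (simp add: SubE_def)
  let ?a = "1 / (4 * s)"
  have a: "0 \<le> ?a" "?a \<le> 1" using s by (auto simp: field_simps)
  have "exp ?a \<le> 1 + ?a + ?a\<^sup>2" using a by (rule exp_bound)
  also have "?a\<^sup>2 \<le> ?a" using mult_left_le[OF a(2,1)] unfolding power2_eq_square .
  finally have e: "exp ?a - 1 \<le> 1 / (2 * s)" by simp
  have "(\<integral>\<^sup>+ y. ennreal (exp (?a * real y)) \<partial>measure_pmf (mixture_pmf G))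
      = (\<integral>\<^sup>+ \<theta>. ennreal (exp (\<theta> * (exp ?a - 1))) \<partial>G)"
    by (rule nn_integral_mixture_exp[OF G0])
  also have "\<dots> \<le> (\<integral>\<^sup>+ \<theta>. ennreal (exp (1 / (2 * s) * \<theta>)) \<partial>G)"
  proof (rule nn_integral_mono_AE, use prob_on_AE[OF G0] in eventually_elim)
    fix \<theta> :: real assume "\<theta> \<in> {0..}"
    then have "\<theta> * (exp ?a - 1) \<le> \<theta> * (1 / (2 * s))" by (intro mult_left_mono e) auto
    then show "ennreal (exp (\<theta> * (exp ?a - 1))) \<le> ennreal (exp (1 / (2 * s) * \<theta>))"
      by (intro ennreal_leI) (simp add: mult.commute)
  qed
  also have "\<dots> \<le> ennreal (2 * exp (1/2) / (1 - exp (-1/2)))"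
    using s by (intro subexp_exp_moment[OF G]) auto
  finally show ?thesis .
qed

text \<open>Permits the passage from \<open>s\<close> to \<open>max 1 s\<close>, the origin of
  \<open>max 1 (s ^ 3)\<close>.\<close>

lemma SubE_mono:
  assumes "0 < s" "s \<le> s'"
  shows "SubE s \<subseteq> SubE s'"
proof
  fix G assume G: "G \<in> SubE s"
  have "2 * exp (- t / s) \<le> 2 * exp (- t / s')" if "0 < t" for t
    using assms that by (simp add: frac_le)
  then show "G \<in> SubE s'" using G unfolding SubE_def by (force intro: order_trans)
qed

section \<open>Regret bounds\<close>

lemma ln_ge_3:
  assumes "n \<ge> (3::nat)"
  shows "1 < ln (real n)"
proof -
  have "exp 1 < real n" using e_less_272 assms by linarith
  then show ?thesis using assms by (subst ln_exp[of 1, symmetric], subst ln_less_cancel_iff) auto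
qed

text \<open>With \<open>b = 1\<close> in the tail bound, a Chernoff exponent \<open>a\<close> yields
  decay \<open>(a - 1) * K\<close> against growth \<open>h * (exp a - 1)\<close>. Each branch of the
  minimum has its own exponent: \<open>1 + ln L\<close> turns the decay into
  \<open>8 * m * L\<close> and the growth into at most \<open>3 * m * L\<close>, while the constant
  2 keeps the growth below \<open>8 * h\<close>. The factor 8 in \<open>K\<close> wins in both
  cases.\<close>

lemma bounded_tail_rate:
  fixes h L K m :: real
  assumes h: "0 < h" and L: "1 < L" and m: "m = max 1 h"
    and K: "K = 8 * min (m * (L / ln L)) (h + L)"
  shows "1 \<le> K" "m \<le> K"
    and "\<exists>a\<ge>1. - (a - 1) * K + h * (exp a - 1) \<le> - 2 * L"
proof -
  have lL: "0 < ln L" "ln L < L" using L by auto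
  have r: "1 \<le> L / ln L" using lL by simp
  have mm: "m \<le> m * (L / ln L)" using mult_left_mono[OF r, of m] m by simp
  have "m \<le> h + L" using h L m by auto
  then have "m \<le> min (m * (L / ln L)) (h + L)" using mm by simp
  moreover have "m \<le> 8 * w" if "m \<le> w" for w using that m by linarith
  ultimately show "m \<le> K" unfolding K by blast
  then show "1 \<le> K" using m by linarith
  have e1: "exp 1 \<le> (3::real)" by (rule exp_le)
  show "\<exists>a\<ge>1. - (a - 1) * K + h * (exp a - 1) \<le> - 2 * L"
  proof (cases "m * (L / ln L) \<le> h + L")
    case True
    then have K': "K = 8 * (m * (L / ln L))" by (simp add: K)
    have "h * (exp (1 + ln L) - 1) \<le> m * exp (1 + ln L)"
      using h m lL by (intro mult_mono) auto
    also have "\<dots> = (m * L) * exp 1" using L by (simp add: exp_add)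
    also have "\<dots> \<le> (m * L) * 3" using e1 m L by (intro mult_left_mono) auto
    finally have "h * (exp (1 + ln L) - 1) \<le> 3 * (m * L)" by simp
    moreover have "- ((1 + ln L) - 1) * K = - 8 * (m * L)" using lL L by (simp add: K')
    moreover have "L \<le> m * L" using m L by simp
    ultimately have "- ((1 + ln L) - 1) * K + h * (exp (1 + ln L) - 1) \<le> - 2 * L" using L by linarith
    then show ?thesis using lL L by (intro exI[of _ "1 + ln L"]) auto
  next
    case False
    then have K': "K = 8 * (h + L)" by (simp add: K)
    have "exp (2::real) = exp 1 * exp 1" by (simp flip: exp_add)
    also have "\<dots> \<le> 3 * 3" using e1 by (intro mult_mono) auto
    finally have "h * (exp 2 - 1) \<le> h * 8" using h by (intro mult_left_mono) auto
    moreover have "- (2 - 1) * K = - 8 * h - 8 * L" by (simp add: K')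
    ultimately have "- (2 - 1) * K + h * (exp 2 - 1) \<le> - 2 * L" using L by linarith
    then show ?thesis by (intro exI[of _ 2]) auto
  qed
qed

text \<open>Optimality of \<open>Ghat\<close> enters only against the true prior, so both estimators
  are instances, with different \<open>M\<close>. The 2 in place of \<open>A\<close> is
  \<open>2 / b\<^sup>2\<close> at \<open>b = 1\<close>.\<close>

lemma regret_min_dist_bounded:
  fixes \<kappa>1 \<kappa>2 h M K :: real and n :: nat
  assumes pos: "0 < \<kappa>1" "0 < \<kappa>2" and sw: "sandwiched \<kappa>1 \<kappa>2 dst"
    and h: "0 < h" and n: "n \<ge> 3" and G: "G \<in> prob_on {0..h}"
    and K: "K = 8 * min (max 1 h * (ln (real n) / ln (ln (real n)))) (h + ln (real n))"
    and M: "max 1 h \<le> M" "M \<le> K"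
    and min: "\<And>ys. length ys = n \<Longrightarrow> dst (empirical ys) (mixture_pmf (Ghat ys)) \<le> dst (empirical ys) (mixture_pmf G)"
    and small: "\<And>ys. length ys = n \<Longrightarrow> \<forall>y\<in>set ys. real y \<le> K \<Longrightarrow> Ghat ys \<in> prob_on {0..M}"
    and large: "\<And>ys. length ys = n \<Longrightarrow> \<exists>y\<in>set ys. K < real y \<Longrightarrow> Ghat ys \<in> prob_on {0..real (Max (set ys))}"
  shows "regret n Ghat G \<le> ennreal ((48 * (4 * \<kappa>2 / \<kappa>1) * (2 + 2) + 10 * 2 + 2 * 2\<^sup>2) * (K\<^sup>2 * M / real n))"
proof (rule regret_le)
  define L where "L = ln (real n)"
  have L: "1 < L" unfolding L_def using n by (rule ln_ge_3)
  note rate = bounded_tail_rate[OF h L refl K[folded L_def]]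
  have KM: "1 \<le> K\<^sup>2 * M" using rate(1) M mult_mono[of 1 "K\<^sup>2" 1 M] by (simp add: one_le_power)
  show G0: "G \<in> prob_on {0..}" using G by (rule prob_on_mono) auto
  have u: "bayes_estimator G y \<le> h" "0 \<le> bayes_estimator G y" for y
    using bayes_estimator_le[OF G] bayes_estimator_nonneg[OF G0] h by auto
  obtain a where a: "1 \<le> a" "- (a - 1) * K + h * (exp a - 1) \<le> - 2 * L" using rate(3) by blast
  have "(\<integral>\<^sup>+ y. ennreal ((real y)\<^sup>2) * indicator {y. K < real y} y \<partial>measure_pmf (mixture_pmf G))
      \<le> ennreal (2 / 1\<^sup>2 * exp (- (a - 1) * K) * exp (h * (exp a - 1)))"
    using a by (intro nn_integral_sq_tail_le mixture_exp_moment_bounded G) auto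
  also have "\<dots> \<le> ennreal (2 * K\<^sup>2 * M / (real n)\<^sup>2)"
  proof (rule ennreal_leI)
    have "exp (- (a - 1) * K) * exp (h * (exp a - 1)) \<le> exp (- 2 * L)"
      using a(2) by (simp flip: exp_add)
    also have "\<dots> = 1 / (real n)\<^sup>2"
      using n by (simp add: L_def exp_minus exp_double power2_eq_square field_simps)
    finally have "2 * (exp (- (a - 1) * K) * exp (h * (exp a - 1))) \<le> 2 * (1 / (real n)\<^sup>2)" by simp
    also have "\<dots> \<le> 2 * (K\<^sup>2 * M / (real n)\<^sup>2)"
      using KM by (intro mult_left_mono divide_right_mono) auto
    finally show "2 / 1\<^sup>2 * exp (- (a - 1) * K) * exp (h * (exp a - 1)) \<le> 2 * K\<^sup>2 * M / (real n)\<^sup>2"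
      by simp
  qed
  finally show "(\<integral>\<^sup>+ y. ennreal ((real y)\<^sup>2) * indicator {y. K < real y} y \<partial>measure_pmf (mixture_pmf G))
      \<le> ennreal (2 * K\<^sup>2 * M / (real n)\<^sup>2)" .
  have hK: "h\<^sup>2 \<le> K\<^sup>2" using h M by (intro power_mono) auto
  have "(\<integral>\<^sup>+ y. ennreal ((bayes_estimator G y)\<^sup>2) \<partial>measure_pmf (mixture_pmf G))
      \<le> (\<integral>\<^sup>+ y. ennreal (2 * K\<^sup>2) \<partial>measure_pmf (mixture_pmf G))"
  proof (intro nn_integral_mono ennreal_leI)
    fix y
    have "(bayes_estimator G y)\<^sup>2 \<le> h\<^sup>2" using u by (intro power_mono) auto
    then show "(bayes_estimator G y)\<^sup>2 \<le> 2 * K\<^sup>2" using hK by (smt (verit) zero_le_power2)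
  qed
  also have "\<dots> = ennreal (2 * K\<^sup>2)" by (simp add: measure_pmf.emeasure_space_1)
  finally show "(\<integral>\<^sup>+ y. ennreal ((bayes_estimator G y)\<^sup>2) \<partial>measure_pmf (mixture_pmf G)) \<le> ennreal (2 * K\<^sup>2)" .
  \<comment> \<open>The true posterior mean never exceeds \<open>h\<close>, so nothing lies above
    \<open>M\<close>.\<close>
  have "{y. M < bayes_estimator G y} = {}" using u M by (auto simp: not_less intro: order_trans)
  then show "(\<integral>\<^sup>+ y. ennreal ((bayes_estimator G y)\<^sup>2) * indicator {y. M < bayes_estimator G y} y
        \<partial>measure_pmf (mixture_pmf G)) \<le> ennreal (2 * K\<^sup>2 * M / real n)"
    by simp
  show "0 < 4 * \<kappa>2 / \<kappa>1" using pos by simp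
  show "hellinger_sq (mixture_pmf G) (mixture_pmf (Ghat ys)) \<le> ennreal (4 * \<kappa>2 / \<kappa>1) * chi_sq (empirical ys) (mixture_pmf G)"
    if "length ys = n" for ys
    by (rule hellinger_min_dist_le[OF sw pos min[OF that]])
  show "Ghat ys \<in> prob_on {0..M}" if "length ys = n" "\<forall>y\<in>set ys. real y \<le> K" for ys
    by (rule small[OF that])
  show "Ghat ys \<in> prob_on {0..real (Max (set ys))}" if "length ys = n" "\<exists>y\<in>set ys. K < real y" for ys
    by (rule large[OF that])
  show "1 \<le> M" using M(1) by simp
  show "0 < n" using n by simp
qed (use M(2) in simp_all)

text \<open>\<open>K\<close> is tuned to the rate \<open>1 / (4 * s)\<close> of the observations:
  half of it pays for the square, the other half turns \<open>K\<close> into n^-2.\<close>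

lemma regret_min_dist_subexp:
  fixes \<kappa>1 \<kappa>2 s K :: real and n :: nat
  assumes pos: "0 < \<kappa>1" "0 < \<kappa>2" and sw: "sandwiched \<kappa>1 \<kappa>2 dst"
    and s: "1 \<le> s" and n: "n \<ge> 2" and G: "G \<in> SubE s"
    and K: "K = 16 * s * ln (real n)"
    and C: "C = 2 * exp (1/2) / (1 - exp (-1/2))"
    and min: "\<And>ys. length ys = n \<Longrightarrow> dst (empirical ys) (mixture_pmf (Ghat ys)) \<le> dst (empirical ys) (mixture_pmf G)"
    and supp: "\<And>ys. length ys = n \<Longrightarrow> Ghat ys \<in> prob_on {0..real (Max (set ys))}"
  shows "regret n Ghat G \<le>
    ennreal ((48 * (4 * \<kappa>2 / \<kappa>1) * (2 + 2 * C) + 10 * (2 * C) + 2 * (2 * C)\<^sup>2) * (K\<^sup>2 * K / real n))"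
proof (rule regret_le)
  define L where "L = ln (real n)"
  have "ln 2 \<le> L" unfolding L_def using n by simp
  then have L: "2 / 3 \<le> L" using ln2_ge_two_thirds by linarith
  \<comment> \<open>From \<open>L \<ge> 2 / 3\<close> even \<open>K \<ge> 32 / 3 * s\<close>. The
    weaker bound suffices for \<open>K\<^sup>2\<close> to dominate the constants
    \<open>2 / b\<^sup>2\<close>, which are multiples of \<open>s\<^sup>2\<close>.\<close>
  have Ks: "8 * s \<le> K" using mult_left_mono[OF L, of "16 * s"] s by (simp add: K L_def[symmetric])
  have K1: "1 \<le> K" using Ks s by linarith
  have K64: "64 * s\<^sup>2 \<le> K\<^sup>2" using power_mono[OF Ks, of 2] s by (simp add: power_mult_distrib)
  have C0: "0 \<le> C" unfolding C by simp
  have "K\<^sup>2 * 1 \<le> K\<^sup>2 * K" by (rule mult_left_mono[OF K1]) simp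
  then have KK: "64 * s\<^sup>2 \<le> K\<^sup>2 * K" using K64 by linarith
  show G0: "G \<in> prob_on {0..}" using G by (simp add: SubE_def)
  have u: "0 \<le> bayes_estimator G y" for y by (rule bayes_estimator_nonneg[OF G0])
  have E: "(\<integral>\<^sup>+ y. ennreal (exp (1 / (2 * s) * bayes_estimator G y)) \<partial>measure_pmf (mixture_pmf G)) \<le> ennreal C"
    using nn_integral_exp_bayes_le[OF G0] subexp_exp_moment[OF G] s unfolding C by (meson less_le_trans order_trans zero_less_one)
  have "(\<integral>\<^sup>+ y. ennreal ((real y)\<^sup>2) * indicator {y. K < real y} y \<partial>measure_pmf (mixture_pmf G))
      \<le> ennreal (2 / (1 / (8 * s))\<^sup>2 * exp (- (1 / (4 * s) - 1 / (8 * s)) * K) * C)"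
    using s C0 subexp_mixture_exp_moment[OF G s] unfolding C
    by (intro nn_integral_sq_tail_le) (auto simp: field_simps)
  also have "\<dots> \<le> ennreal (2 * C * K\<^sup>2 * K / (real n)\<^sup>2)"
  proof (rule ennreal_leI)
    have "- (1 / (4 * s) - 1 / (8 * s)) * K = - 2 * L" using s by (simp add: K L_def field_simps)
    then have "exp (- (1 / (4 * s) - 1 / (8 * s)) * K) = 1 / (real n)\<^sup>2"
      using n by (simp add: L_def exp_minus exp_double power2_eq_square field_simps)
    then have "2 / (1 / (8 * s))\<^sup>2 * exp (- (1 / (4 * s) - 1 / (8 * s)) * K) * C = 2 * C * (64 * s\<^sup>2) / (real n)\<^sup>2"
      using s by (simp add: power_divide power_mult_distrib)
    also have "\<dots> \<le> 2 * C * (K\<^sup>2 * K) / (real n)\<^sup>2"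
      using KK C0 by (intro divide_right_mono mult_left_mono) auto
    finally show "2 / (1 / (8 * s))\<^sup>2 * exp (- (1 / (4 * s) - 1 / (8 * s)) * K) * C \<le> 2 * C * K\<^sup>2 * K / (real n)\<^sup>2"
      by (simp add: mult.assoc)
  qed
  finally show "(\<integral>\<^sup>+ y. ennreal ((real y)\<^sup>2) * indicator {y. K < real y} y \<partial>measure_pmf (mixture_pmf G))
      \<le> ennreal (2 * C * K\<^sup>2 * K / (real n)\<^sup>2)" .
  \<comment> \<open>Equal exponents and the threshold -1, below every posterior mean, give the full
    second moment.\<close>
  have "(\<integral>\<^sup>+ y. ennreal ((bayes_estimator G y)\<^sup>2) * indicator {y. - 1 < bayes_estimator G y} y
        \<partial>measure_pmf (mixture_pmf G))
      \<le> ennreal (2 / (1 / (2 * s))\<^sup>2 * exp (- (1 / (2 * s) - 1 / (2 * s)) * - 1) * C)"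
    using s C0 by (intro nn_integral_sq_tail_le u E) auto
  also have "{y. - 1 < bayes_estimator G y} = UNIV" using u by (auto intro: less_le_trans[of _ 0])
  also have "2 / (1 / (2 * s))\<^sup>2 * exp (- (1 / (2 * s) - 1 / (2 * s)) * - 1) * C = C * (8 * s\<^sup>2)"
    by (simp add: power_divide power_mult_distrib)
  also have "ennreal (C * (8 * s\<^sup>2)) \<le> ennreal (C * (2 * K\<^sup>2))"
  proof (intro ennreal_leI mult_left_mono C0)
    show "8 * s\<^sup>2 \<le> 2 * K\<^sup>2" using K64 zero_le_power2[of s] by linarith
  qed
  finally show "(\<integral>\<^sup>+ y. ennreal ((bayes_estimator G y)\<^sup>2) \<partial>measure_pmf (mixture_pmf G)) \<le> ennreal (2 * C * K\<^sup>2)"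
    by (simp add: ac_simps)
  \<comment> \<open>The rate is now \<open>1 / (2 * s)\<close>, half of it spent on the square; the
    remaining decay n^-4 is more than the n^-1 asked for.\<close>
  have "(\<integral>\<^sup>+ y. ennreal ((bayes_estimator G y)\<^sup>2) * indicator {y. K < bayes_estimator G y} y
        \<partial>measure_pmf (mixture_pmf G))
      \<le> ennreal (2 / (1 / (4 * s))\<^sup>2 * exp (- (1 / (2 * s) - 1 / (4 * s)) * K) * C)"
    using s C0 by (intro nn_integral_sq_tail_le u E) (auto simp: field_simps)
  also have "\<dots> \<le> ennreal (2 * C * K\<^sup>2 * K / real n)"
  proof (rule ennreal_leI)
    have "- (1 / (2 * s) - 1 / (4 * s)) * K = - 4 * L" using s by (simp add: K L_def field_simps)
    also have "\<dots> \<le> - L" using L by simp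
    finally have "exp (- (1 / (2 * s) - 1 / (4 * s)) * K) \<le> exp (- L)" by simp
    also have "\<dots> = 1 / real n" using n by (simp add: L_def exp_minus field_simps)
    finally have "2 * (16 * s\<^sup>2) * C * exp (- (1 / (2 * s) - 1 / (4 * s)) * K) \<le> 2 * (16 * s\<^sup>2) * C * (1 / real n)"
      using C0 by (intro mult_left_mono) auto
    also have "\<dots> = 2 * C * (16 * s\<^sup>2) / real n" by simp
    also have "\<dots> \<le> 2 * C * (K\<^sup>2 * K) / real n"
    proof (intro divide_right_mono mult_left_mono)
      show "16 * s\<^sup>2 \<le> K\<^sup>2 * K" using KK zero_le_power2[of s] by linarith
    qed (use C0 in simp_all)
    finally show "2 / (1 / (4 * s))\<^sup>2 * exp (- (1 / (2 * s) - 1 / (4 * s)) * K) * C \<le> 2 * C * K\<^sup>2 * K / real n"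
      using s by (simp add: power_divide power_mult_distrib ac_simps)
  qed
  finally show "(\<integral>\<^sup>+ y. ennreal ((bayes_estimator G y)\<^sup>2) * indicator {y. K < bayes_estimator G y} y
        \<partial>measure_pmf (mixture_pmf G)) \<le> ennreal (2 * C * K\<^sup>2 * K / real n)" .
  show "0 < 4 * \<kappa>2 / \<kappa>1" using pos by simp
  show "hellinger_sq (mixture_pmf G) (mixture_pmf (Ghat ys)) \<le> ennreal (4 * \<kappa>2 / \<kappa>1) * chi_sq (empirical ys) (mixture_pmf G)"
    if "length ys = n" for ys
    by (rule hellinger_min_dist_le[OF sw pos min[OF that]])
  show "Ghat ys \<in> prob_on {0..K}" if l: "length ys = n" and y: "\<forall>y\<in>set ys. real y \<le> K" for ys
  proof (rule prob_on_mono[OF supp[OF l]])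
    have "Max (set ys) \<in> set ys" using l n by (intro Max_in) auto
    then show "{0..real (Max (set ys))} \<subseteq> {0..K}" using y by auto
  qed auto
  show "Ghat ys \<in> prob_on {0..real (Max (set ys))}" if "length ys = n" for ys by (rule supp[OF that])
  show "1 \<le> K" "K \<le> K" "0 < n" "0 \<le> 2 * C" using K1 n C0 by auto
qed

theorem theorem3:
  fixes \<kappa>1 \<kappa>2 :: real
  assumes "\<kappa>1 > 0" and "\<kappa>2 > 0"
  shows
    "(\<exists>c1 c2 :: real.
        \<forall>dst. generalized_distance dst \<longrightarrow> decomposable dst \<longrightarrow> sandwiched \<kappa>1 \<kappa>2 dst \<longrightarrow>
          (\<forall>h>0. \<forall>s>0.
            (\<forall>n\<ge>3. regret_class n (min_dist_estimator dst {0..}) (prob_on {0..h})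
               \<le> ennreal (c1 / real n *
                    (min (max 1 h * (ln (real n) / ln (ln (real n)))) (h + ln (real n))) ^ 3)) \<and>
            (\<forall>n\<ge>2. regret_class n (min_dist_estimator dst {0..}) (SubE s)
               \<le> ennreal (c2 * max 1 (s ^ 3) / real n * ln (real n) ^ 3))))
     \<and>
     (\<forall>h>0. \<exists>c1 :: real.
        \<forall>dst. generalized_distance dst \<longrightarrow> decomposable dst \<longrightarrow> sandwiched \<kappa>1 \<kappa>2 dst \<longrightarrow>
          (\<forall>n\<ge>3. regret_class n (min_dist_estimator dst {0..h}) (prob_on {0..h})
             \<le> ennreal (c1 / real n *
                  (min (max 1 h * (ln (real n) / ln (ln (real n)))) (h + ln (real n))) ^ 2)))"
proof -
  \<comment> \<open>\<open>K\<close> is \<open>8 * W h n\<close> for bounded priors and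
    \<open>16 * S * ln n\<close> for subexponential ones; the powers 512, 64 and 4096 of these
    factors turn \<open>D\<close> and \<open>D'\<close> into the final constants.\<close>
  define W where "W h n = min (max 1 h * (ln (real n) / ln (ln (real n)))) (h + ln (real n))" for h n
  define D where "D = 48 * (4 * \<kappa>2 / \<kappa>1) * (2 + 2) + 10 * 2 + 2 * (2::real)\<^sup>2"
  define C where "C = 2 * exp (1/2) / (1 - exp (-1/2::real))"
  define D' where "D' = 48 * (4 * \<kappa>2 / \<kappa>1) * (2 + 2 * C) + 10 * (2 * C) + 2 * (2 * C)\<^sup>2"
  have nonempty: "ys \<noteq> []" if "length ys = n" "2 \<le> n" for ys :: "nat list" and n using that by auto
  have bounded_sub: "G \<in> prob_on {0..}" if "G \<in> prob_on {0..h}" for G and h :: real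
    using that by (rule prob_on_mono) auto
  have W: "max 1 h \<le> 8 * W h n" if "0 < h" "3 \<le> n" for h n
    using bounded_tail_rate(2)[OF that(1) ln_ge_3[OF that(2)] refl refl] by (simp only: W_def)
  have a: "regret n (min_dist_estimator dst {0..}) G \<le> ennreal (512 * D / real n * W h n ^ 3)"
    if dec: "decomposable dst" and sw: "sandwiched \<kappa>1 \<kappa>2 dst" and h: "0 < h" and n: "3 \<le> n"
      and G: "G \<in> prob_on {0..h}" for dst h n G
  proof -
    have ne: "ys \<noteq> []" if "length ys = n" for ys :: "nat list" using nonempty[OF that] n by simp
    have "regret n (min_dist_estimator dst {0..}) G \<le> ennreal (D * ((8 * W h n)\<^sup>2 * (8 * W h n) / real n))"
      unfolding D_def
    proof (rule regret_min_dist_bounded[OF assms sw h n G])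
      show "8 * W h n = 8 * min (max 1 h * (ln (real n) / ln (ln (real n)))) (h + ln (real n))"
        by (simp only: W_def)
      show "max 1 h \<le> 8 * W h n" by (rule W[OF h n])
      show "dst (empirical ys) (mixture_pmf (min_dist_estimator dst {0..} ys)) \<le> dst (empirical ys) (mixture_pmf G)"
        if "length ys = n" for ys
        by (rule is_arg_min_min_dist_estimator(2)[where dst = dst and \<Theta> = "{0..}", OF exists_min_dist_unbounded[OF dec ne[OF that]] bounded_sub[OF G]])
      show "min_dist_estimator dst {0..} ys \<in> prob_on {0..8 * W h n}"
        if l: "length ys = n" and y: "\<forall>y\<in>set ys. real y \<le> 8 * W h n" for ys
      proof (rule prob_on_mono[OF min_dist_estimator_support[OF dec ne[OF l]]])
        have "Max (set ys) \<in> set ys" using ne[OF l] by (intro Max_in) auto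
        then show "{0..real (Max (set ys))} \<subseteq> {0..8 * W h n}" using y by auto
      qed simp
      show "min_dist_estimator dst {0..} ys \<in> prob_on {0..real (Max (set ys))}" if "length ys = n" for ys
        by (rule min_dist_estimator_support[OF dec ne[OF that]])
    qed simp
    also have "D * ((8 * W h n)\<^sup>2 * (8 * W h n) / real n) = 512 * D / real n * W h n ^ 3"
      by (simp add: power2_eq_square power3_eq_cube)
    finally show ?thesis .
  qed
  have b: "regret n (min_dist_estimator dst {0..}) G \<le> ennreal (4096 * D' * max 1 (s ^ 3) / real n * ln (real n) ^ 3)"
    if dec: "decomposable dst" and sw: "sandwiched \<kappa>1 \<kappa>2 dst" and s: "0 < s" and n: "2 \<le> n"
      and G: "G \<in> SubE s" for dst s n G
  proof -
    define S where "S = max 1 s"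
    have ne: "ys \<noteq> []" if "length ys = n" for ys :: "nat list" using nonempty[OF that n] .
    have G': "G \<in> SubE S" using SubE_mono[of s S] s G by (auto simp: S_def)
    have S: "S ^ 3 = max 1 (s ^ 3)"
    proof (cases "1 \<le> s")
      case True
      then show ?thesis by (simp add: S_def max_def one_le_power)
    next
      case False
      then have "s ^ 3 \<le> 1" using s by (intro power_le_one) auto
      then show ?thesis using False by (simp add: S_def max_def)
    qed
    have "regret n (min_dist_estimator dst {0..}) G
        \<le> ennreal (D' * ((16 * S * ln (real n))\<^sup>2 * (16 * S * ln (real n)) / real n))"
      unfolding D'_def
    proof (rule regret_min_dist_subexp[OF assms sw _ n G' refl C_def])
      show "1 \<le> S" by (simp add: S_def)
      have "G \<in> prob_on {0..}" using G by (simp add: SubE_def)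
      then show "dst (empirical ys) (mixture_pmf (min_dist_estimator dst {0..} ys)) \<le> dst (empirical ys) (mixture_pmf G)"
        if "length ys = n" for ys
        by (rule is_arg_min_min_dist_estimator(2)[where dst = dst and \<Theta> = "{0..}", OF exists_min_dist_unbounded[OF dec ne[OF that]]])
      show "min_dist_estimator dst {0..} ys \<in> prob_on {0..real (Max (set ys))}" if "length ys = n" for ys
        by (rule min_dist_estimator_support[OF dec ne[OF that]])
    qed
    also have "D' * ((16 * S * ln (real n))\<^sup>2 * (16 * S * ln (real n)) / real n)
        = 4096 * D' * S ^ 3 / real n * ln (real n) ^ 3"
      by (simp add: power2_eq_square power3_eq_cube)
    finally show ?thesis unfolding S .
  qed
  have c: "regret n (min_dist_estimator dst {0..h}) G \<le> ennreal (64 * max 1 h * D / real n * W h n ^ 2)"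
    if dec: "decomposable dst" and sw: "sandwiched \<kappa>1 \<kappa>2 dst" and h: "0 < h" and n: "3 \<le> n"
      and G: "G \<in> prob_on {0..h}" for dst h n G
  proof -
    have ne: "ys \<noteq> []" if "length ys = n" for ys :: "nat list" using nonempty[OF that] n by simp
    note m = is_arg_min_min_dist_estimator[where dst = dst and \<Theta> = "{0..h}", OF exists_min_dist_bounded[OF dec ne less_imp_le[OF h]]]
    \<comment> \<open>With \<open>M = max 1 h\<close> one of the three factors no longer grows with
      \<open>n\<close>; it goes into \<open>c1\<close>, which therefore depends on
      \<open>h\<close>.\<close>
    have "regret n (min_dist_estimator dst {0..h}) G \<le> ennreal (D * ((8 * W h n)\<^sup>2 * max 1 h / real n))"
      unfolding D_def
    proof (rule regret_min_dist_bounded[OF assms sw h n G])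
      show "8 * W h n = 8 * min (max 1 h * (ln (real n) / ln (ln (real n)))) (h + ln (real n))"
        by (simp only: W_def)
      show "max 1 h \<le> 8 * W h n" by (rule W[OF h n])
      show "dst (empirical ys) (mixture_pmf (min_dist_estimator dst {0..h} ys)) \<le> dst (empirical ys) (mixture_pmf G)"
        if "length ys = n" for ys
        by (rule m(2)[OF that G])
      show "min_dist_estimator dst {0..h} ys \<in> prob_on {0..max 1 h}" if l: "length ys = n" for ys
        by (rule prob_on_mono[OF m(1)[OF l]]) auto
      show "min_dist_estimator dst {0..h} ys \<in> prob_on {0..real (Max (set ys))}"
        if l: "length ys = n" and y: "\<exists>y\<in>set ys. 8 * W h n < real y" for ys
      proof (rule prob_on_mono[OF m(1)[OF l]])
        obtain y where y: "y \<in> set ys" "8 * W h n < real y" using y by blast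
        then have "y \<le> Max (set ys)" by simp
        \<comment> \<open>A sample reaching beyond \<open>8 * W h n\<close> also exceeds
          \<open>h\<close>, so support in \<open>{0..h}\<close> is stronger than what is
          required.\<close>
        then have "h \<le> real (Max (set ys))" using y(2) W[OF h n] by linarith
        then show "{0..h} \<subseteq> {0..real (Max (set ys))}" by auto
      qed simp
    qed simp
    also have "D * ((8 * W h n)\<^sup>2 * max 1 h / real n) = 64 * max 1 h * D / real n * W h n ^ 2"
      by (simp add: power2_eq_square)
    finally show ?thesis .
  qed
  show ?thesis
    unfolding regret_class_def W_def[symmetric]
  proof (rule conjI, goal_cases)
    case 1
    show ?case
      by (intro exI[of _ "512 * D"] exI[of _ "4096 * D'"] allI impI conjI SUP_least) (rule a b; assumption)+
  next
    case 2
    show ?case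
    proof (intro allI impI)
      fix h :: real assume h: "0 < h"
      show "\<exists>c1. \<forall>dst. generalized_distance dst \<longrightarrow> decomposable dst \<longrightarrow> sandwiched \<kappa>1 \<kappa>2 dst \<longrightarrow>
          (\<forall>n\<ge>3. (SUP G\<in>prob_on {0..h}. regret n (min_dist_estimator dst {0..h}) G)
            \<le> ennreal (c1 / real n * (W h n)\<^sup>2))"
        by (intro exI[of _ "64 * max 1 h * D"] allI impI SUP_least c h)
    qed
  qed
qed

end
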